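(* Assume that $g>0$, $H_\chi\in\mathbb{R}^{n\times n}$, $X_\chi\in\mathbb{R}^{n\times n}$, $Z_{\chi,\chi'}\in\mathbb{R}^{n\times n}$, $G_{\gamma,\delta}\in\mathbb{R}^{n\times n}$ and $F_{\gamma,\delta}\in\mathbb{R}^{m\times n}$ (for $\chi=(\alpha,\beta,\gamma,\delta)$ and $\chi'$ in $\mathfrak X$) satisfy the linear matrix inequalities $$\begin{bmatrix} G_{\gamma,\delta}+G_{\gamma,\delta}^\top-X_\chi & \star&\star&\star\\ O& gI&\star&\star\\ A_\alpha G_{\gamma,\delta}+B_\alpha F_{\gamma,\delta}& E_\alpha & H_\chi+H_\chi^\top-\bar{\mathcal F}_\chi(Z)&\star\\ C_\alpha G_{\gamma,\delta}+D_\alpha F_{\gamma,\delta}&O&O&I\end{bmatrix}>0,\qquad \begin{bmatrix} Z_{\chi,\chi'}&\star\\ H_\chi& X_{\chi'}\end{bmatrix}>0$$ for all $\chi=(\alpha,\beta,\gamma,\delta)$ and $\chi'$ in $\mathfrak X$. Define $K_{\gamma,\delta}=F_{\gamma,\delta}G_{\gamma,\delta}^{-1}$ for $\gamma\in[N]$, $\delta\in[T]$. Then the closed-loop system $\Sigma_K$ is mean square stable and satisfies $\|\Sigma_K\|_\infty^2<g$.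
   Context: Notation. $[N]=\{1,\dots,N\}$; $\mathbb N$ is the set of nonnegative integers; for an integer $k$ and positive integer $T$, $\lfloor k\rfloor_T$ is the unique element of $\{0,\dots,T-1\}$ congruent to $k$ modulo $T$; $\mathbf 1(\cdot)$ is the indicator of a condition; $\|\cdot\|$ is the Euclidean norm; $A>0$ means that $A$ is real symmetric positive definite; $\star$ denotes a block determined by symmetry; $O$, $I$ are zero and identity matrices of suitable size. Open-loop system. $n,m,q,\ell,N,M,T$ are positive integers. For $i\in[N]$, $A_i\in\mathbb{R}^{n\times n}$, $B_i\in\mathbb{R}^{n\times m}$, $C_i\in\mathbb{R}^{\ell\times n}$, $D_i\in\mathbb{R}^{\ell\times m}$, $E_i\in\mathbb{R}^{n\times q}$. The mode $r=\{r(k)\}_{k\ge0}$ is a time-homogeneous Markov chain on $[N]$ with transition matrix $P=(p_{\alpha\alpha'})$, and $s=\{s(k)\}_{k\ge0}$ is a time-homogeneous Markov chain on $[M]$ with transition matrix $(q_{\beta\beta'})$, independent of $r$. The system is $x(k+1)=A_{r(k)}x(k)+B_{r(k)}u(k)+E_{r(k)}w(k)$, $z(k)=C_{r(k)}x(k)+D_{r(k)}u(k)$, with $x(0)=x_0$, $r(0)=r_0$, $s(0)=s_0$. Observation process. A function $f:[M]\to\{0,1\}$ is given. Observation times: $t_0=\min\{k\ge0: f(s(k))=1\}$, $t_{i+1}=\min\{k>t_i: f(s(k))=1\}$ ($\min\emptyset=\infty$). For $k\ge t_0$, $\tau(k)=\max\{t_i: t_i\le k\}$ and $\sigma(k)=r(\tau(k))$;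 for $k<t_0$, $\tau(k)=\tau_0$ and $\sigma(k)=\sigma_0$, where $\tau_0$ is an integer with $\tau_0=0$ if $t_0=0$ and $\tau_0<0$ otherwise, and $\sigma_0\in[N]$ with $\sigma_0=r_0$ if $t_0=0$. Put $\rho(k)=\lfloor k-\tau(k)\rfloor_T+1\in[T]$, $\rho_0=\rho(0)$. Closed loop. Given gains $K_{\gamma,\delta}\in\mathbb{R}^{m\times n}$ ($\gamma\in[N],\delta\in[T]$), the feedback $u(k)=K_{\sigma(k),\rho(k)}x(k)$ gives the closed-loop system $\Sigma_K$: $x(k+1)=(A_{r(k)}+B_{r(k)}K_{\sigma(k),\rho(k)})x(k)+E_{r(k)}w(k)$, $z(k)=(C_{r(k)}+D_{r(k)}K_{\sigma(k),\rho(k)})x(k)$. Let $\bar r(k)=(r(k),s(k),\sigma(k),\rho(k))$, $\bar r_0=\bar r(0)$, and let $\mathfrak X$ be the set of $(\alpha,\beta,\gamma,\delta)\in[N]\times[M]\times[N]\times[T]$ such that $f(\beta)=1$ implies $\alpha=\gamma$ and $\delta=1$; $\bar r$ takes values in $\mathfrak X$. For pairs $(\gamma,\delta)$ that do not occur as the last two components of any element of $\mathfrak X$, the gain $K_{\gamma,\delta}$ never enters the closed loop and may be taken arbitrary. For $\chi=(\alpha,\beta,\gamma,\delta)$, $\chi'=(\alpha',\beta',\gamma',\delta')$ in $\mathfrak X$ put $\bar p_{\chi\chi'}=\mathbf 1(\alpha'=\gamma',\ \delta'=1)\,p_{\alpha\alpha'}q_{\beta\beta'}$ if $f(\beta')=1$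 and $\bar p_{\chi\chi'}=\mathbf 1(\gamma'=\gamma,\ \lfloor\delta'-\delta-1\rfloor_T=0)\,p_{\alpha\alpha'}q_{\beta\beta'}$ otherwise (these are the transition probabilities of $\bar r$). For a family $Z=\{Z_{\chi,\chi'}\}_{\chi,\chi'\in\mathfrak X}\subset\mathbb{R}^{n\times n}$, $\bar{\mathcal F}_\chi(Z)=\sum_{\chi'\in\mathfrak X}\bar p_{\chi\chi'}Z_{\chi,\chi'}$. Mean square stability of $\Sigma_K$: there exist $C>0$ and $\lambda\in[0,1)$ such that, with $w\equiv0$, $E[\|x(k)\|^2]\le C\lambda^k\|x_0\|^2$ for all $x_0\in\mathbb{R}^n$, all $\bar r_0\in\mathfrak X$ and all $k\ge0$. $H_\infty$ norm: let $\Theta_k$ be the $\sigma$-algebra generated by $r(0),s(0),\dots,r(k),s(k)$, and let $\ell^2(\mathbb{R}^q)$ be the space of $\mathbb{R}^q$-valued processes $h=\{h(k)\}_{k\ge0}$ with $h(k)$ $\Theta_k$-measurable and $\|h\|_2^2:=\sum_{k=0}^\infty E[\|h(k)\|^2]<\infty$. For mean square stable $\Sigma_K$ and $x_0=0$, $\|\Sigma_K\|_\infty=\sup_{\bar r_0\in\mathfrak X}\sup_{w\in\ell^2(\mathbb{R}^q)\setminus\{0\}}\|z\|_2/\|w\|_2$. *)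

theory Defs
  imports "HOL-Probability.Probability"
begin

text \<open>
  Conventions.  The index sets \<open>[N]\<close> and \<open>[M]\<close> and the vector dimensions are finite types; a
  \<open>k \<times> l\<close> matrix has type \<open>real ^ 'l ^ 'k\<close>.  The set \<open>[T]\<close> is \<open>{1..T}\<close> of type nat, since its
  elements are subject to arithmetic modulo \<open>T\<close>.  The indicator \<open>f : [M] \<rightarrow> {0,1}\<close> is a predicate,
  with \<open>f \<beta>\<close> standing for \<open>f(\<beta>) = 1\<close>.
\<close>

section \<open>Block matrices\<close>

definition pos_def :: "real ^ 'n ^ 'n \<Rightarrow> bool" where
  "pos_def S \<longleftrightarrow> transpose S = S \<and> (\<forall>v. v \<noteq> 0 \<longrightarrow> v \<bullet> (S *v v) > 0)"

definition stack :: "real ^ 'c ^ 'a \<Rightarrow> real ^ 'c ^ 'b \<Rightarrow> real ^ 'c ^ ('a + 'b)" where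
  "stack S1 S2 = (\<chi> i j. case i of Inl i' \<Rightarrow> S1 $ i' $ j | Inr i' \<Rightarrow> S2 $ i' $ j)"

text \<open>\<open>sym_block2 S11 S21 S22\<close> is the matrix with block rows \<open>S11, S21\<^sup>T\<close> and \<open>S21, S22\<close>; it is
  symmetric only if \<open>S11\<close> and \<open>S22\<close> are.\<close>

definition sym_block2 ::
  "real ^ 'a ^ 'a \<Rightarrow> real ^ 'a ^ 'b \<Rightarrow> real ^ 'b ^ 'b \<Rightarrow> real ^ ('a + 'b) ^ ('a + 'b)" where
  "sym_block2 S11 S21 S22 =
    (\<chi> i j. case i of
        Inl i' \<Rightarrow> (case j of Inl j' \<Rightarrow> S11 $ i' $ j' | Inr j' \<Rightarrow> transpose S21 $ i' $ j')
      | Inr i' \<Rightarrow> (case j of Inl j' \<Rightarrow> S21 $ i' $ j' | Inr j' \<Rightarrow> S22 $ i' $ j'))"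

text \<open>The blocks on and below the diagonal, row by row.\<close>

definition sym_block4 ::
  "real ^ 'a ^ 'a \<Rightarrow>
   real ^ 'a ^ 'b \<Rightarrow> real ^ 'b ^ 'b \<Rightarrow>
   real ^ 'a ^ 'c \<Rightarrow> real ^ 'b ^ 'c \<Rightarrow> real ^ 'c ^ 'c \<Rightarrow>
   real ^ 'a ^ 'd \<Rightarrow> real ^ 'b ^ 'd \<Rightarrow> real ^ 'c ^ 'd \<Rightarrow> real ^ 'd ^ 'd \<Rightarrow>
   real ^ ('a + ('b + ('c + 'd))) ^ ('a + ('b + ('c + 'd)))" where
  "sym_block4 S11 S21 S22 S31 S32 S33 S41 S42 S43 S44 =
    sym_block2 S11 (stack S21 (stack S31 S41))
      (sym_block2 S22 (stack S32 S42) (sym_block2 S33 S43 S44))"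

section \<open>Markov chains\<close>

definition stochastic_matrix :: "('a::finite \<Rightarrow> 'a \<Rightarrow> real) \<Rightarrow> bool" where
  "stochastic_matrix P \<longleftrightarrow> (\<forall>a a'. 0 \<le> P a a') \<and> (\<forall>a. (\<Sum>a'\<in>UNIV. P a a') = 1)"

text \<open>Time-homogeneous Markov chain with transition matrix \<open>P\<close> and (almost sure) initial state
  \<open>a0\<close>.\<close>

definition markov_chain ::
  "'w measure \<Rightarrow> ('a::finite \<Rightarrow> 'a \<Rightarrow> real) \<Rightarrow> 'a \<Rightarrow> (nat \<Rightarrow> 'w \<Rightarrow> 'a) \<Rightarrow> bool" where
  "markov_chain \<Omega> P a0 \<xi> \<longleftrightarrow>
    stochastic_matrix P \<and>
    (\<forall>k. \<xi> k \<in> \<Omega> \<rightarrow>\<^sub>M count_space UNIV) \<and>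
    (AE \<omega> in \<Omega>. \<xi> 0 \<omega> = a0) \<and>
    (\<forall>k a a'. \<P>(\<omega> in \<Omega>. \<forall>j\<le>k. \<xi> j \<omega> = a j) > 0 \<longrightarrow>
       \<P>(\<omega> in \<Omega>. \<xi> (Suc k) \<omega> = a' \<bar> \<forall>j\<le>k. \<xi> j \<omega> = a j) = P (a k) a')"

definition indep_processes ::
  "'w measure \<Rightarrow> (nat \<Rightarrow> 'w \<Rightarrow> 'a) \<Rightarrow> (nat \<Rightarrow> 'w \<Rightarrow> 'b) \<Rightarrow> bool" where
  "indep_processes \<Omega> \<xi> \<eta> \<longleftrightarrow>
    prob_space.indep_set \<Omega>
      (sigma_sets (space \<Omega>) {\<xi> j -` S \<inter> space \<Omega> | j S. True})
      (sigma_sets (space \<Omega>) {\<eta> j -` S \<inter> space \<Omega> | j S. True})"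

text \<open>The definitions of stability and of the norm below vary the initial states of the chains.
  Accordingly \<open>\<Omega> r0 s0\<close> is a probability space carrying independent chains \<open>r r0 s0\<close> and
  \<open>s r0 s0\<close> started at \<open>r0\<close> and \<open>s0\<close>.  No particular construction of these spaces is singled
  out.\<close>

definition mode_processes ::
  "('a::finite \<Rightarrow> 'a \<Rightarrow> real) \<Rightarrow> ('b::finite \<Rightarrow> 'b \<Rightarrow> real) \<Rightarrow> ('a \<Rightarrow> 'b \<Rightarrow> 'w measure) \<Rightarrow>
   ('a \<Rightarrow> 'b \<Rightarrow> nat \<Rightarrow> 'w \<Rightarrow> 'a) \<Rightarrow> ('a \<Rightarrow> 'b \<Rightarrow> nat \<Rightarrow> 'w \<Rightarrow> 'b) \<Rightarrow> bool" where
  "mode_processes p q \<Omega> r s \<longleftrightarrow>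
    (\<forall>r0 s0. prob_space (\<Omega> r0 s0) \<and>
       markov_chain (\<Omega> r0 s0) p r0 (r r0 s0) \<and>
       markov_chain (\<Omega> r0 s0) q s0 (s r0 s0) \<and>
       indep_processes (\<Omega> r0 s0) (r r0 s0) (s r0 s0))"

section \<open>Observation process\<close>

text \<open>In this and the next section \<open>r\<close>, \<open>s\<close> and \<open>w\<close> denote single sample paths.  The infimum
  of the empty set in \<open>enat\<close> is \<open>\<infinity>\<close>.\<close>

primrec obs_time :: "('b \<Rightarrow> bool) \<Rightarrow> (nat \<Rightarrow> 'b) \<Rightarrow> nat \<Rightarrow> enat" where
  "obs_time f s 0 = Inf {enat k | k. f (s k)}"
| "obs_time f s (Suc i) = Inf {enat k | k. obs_time f s i < enat k \<and> f (s k)}"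

definition last_obs :: "('b \<Rightarrow> bool) \<Rightarrow> int \<Rightarrow> (nat \<Rightarrow> 'b) \<Rightarrow> nat \<Rightarrow> int" where
  "last_obs f \<tau>0 s k =
    (if obs_time f s 0 \<le> enat k
     then int (Max {j. j \<le> k \<and> (\<exists>i. obs_time f s i = enat j)}) else \<tau>0)"

definition obs_mode ::
  "('b \<Rightarrow> bool) \<Rightarrow> int \<Rightarrow> 'a \<Rightarrow> (nat \<Rightarrow> 'a) \<Rightarrow> (nat \<Rightarrow> 'b) \<Rightarrow> nat \<Rightarrow> 'a" where
  "obs_mode f \<tau>0 \<sigma>0 r s k =
    (if obs_time f s 0 \<le> enat k then r (nat (last_obs f \<tau>0 s k)) else \<sigma>0)"

definition obs_age :: "('b \<Rightarrow> bool) \<Rightarrow> nat \<Rightarrow> int \<Rightarrow> (nat \<Rightarrow> 'b) \<Rightarrow> nat \<Rightarrow> nat" where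
  "obs_age f T \<tau>0 s k = nat ((int k - last_obs f \<tau>0 s k) mod int T) + 1"

type_synonym ('a, 'b) xstate = "'a \<times> 'b \<times> 'a \<times> nat"

definition xstates :: "('b \<Rightarrow> bool) \<Rightarrow> nat \<Rightarrow> ('a, 'b) xstate set" where
  "xstates f T = {(\<alpha>, \<beta>, \<gamma>, \<delta>). \<delta> \<in> {1..T} \<and> (f \<beta> \<longrightarrow> \<alpha> = \<gamma> \<and> \<delta> = 1)}"

text \<open>The integers \<open>\<tau>0\<close> that realise the initial extended state.  The sign condition reflects that
  \<open>t\<^sub>0 = 0\<close> means that the initial state of \<open>s\<close> satisfies \<open>f\<close>; the last condition is
  \<open>\<rho>(0) = \<rho>0\<close>.  Unless \<open>f s0\<close>, several \<open>\<tau>0\<close> are compatible with the same state.\<close>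

definition initial_time :: "('b \<Rightarrow> bool) \<Rightarrow> nat \<Rightarrow> ('a, 'b) xstate \<Rightarrow> int \<Rightarrow> bool" where
  "initial_time f T =
    (\<lambda>(r0, s0, \<sigma>0, \<rho>0) \<tau>0.
       (if f s0 then \<tau>0 = 0 else \<tau>0 < 0) \<and> nat ((- \<tau>0) mod int T) + 1 = \<rho>0)"

definition xtrans ::
  "('a \<Rightarrow> 'a \<Rightarrow> real) \<Rightarrow> ('b \<Rightarrow> 'b \<Rightarrow> real) \<Rightarrow> ('b \<Rightarrow> bool) \<Rightarrow> nat \<Rightarrow>
   ('a, 'b) xstate \<Rightarrow> ('a, 'b) xstate \<Rightarrow> real" where
  "xtrans p q f T =
    (\<lambda>(\<alpha>, \<beta>, \<gamma>, \<delta>) (\<alpha>', \<beta>', \<gamma>', \<delta>').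
       if f \<beta>' then of_bool (\<alpha>' = \<gamma>' \<and> \<delta>' = 1) * p \<alpha> \<alpha>' * q \<beta> \<beta>'
       else of_bool (\<gamma>' = \<gamma> \<and> (int \<delta>' - int \<delta> - 1) mod int T = 0) * p \<alpha> \<alpha>' * q \<beta> \<beta>')"

definition Fbar ::
  "('a \<Rightarrow> 'a \<Rightarrow> real) \<Rightarrow> ('b \<Rightarrow> 'b \<Rightarrow> real) \<Rightarrow> ('b \<Rightarrow> bool) \<Rightarrow> nat \<Rightarrow>
   (('a, 'b) xstate \<Rightarrow> ('a, 'b) xstate \<Rightarrow> real ^ 'n ^ 'n) \<Rightarrow> ('a, 'b) xstate \<Rightarrow>
   real ^ 'n ^ 'n" where
  "Fbar p q f T Z c = (\<Sum>c'\<in>xstates f T. xtrans p q f T c c' *\<^sub>R Z c c')"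

section \<open>Closed-loop system\<close>

primrec cl_state ::
  "('a \<Rightarrow> real ^ 'n ^ 'n) \<Rightarrow> ('a \<Rightarrow> real ^ 'm ^ 'n) \<Rightarrow> ('a \<Rightarrow> real ^ 'q ^ 'n) \<Rightarrow>
   ('a \<Rightarrow> nat \<Rightarrow> real ^ 'n ^ 'm) \<Rightarrow> ('b \<Rightarrow> bool) \<Rightarrow> nat \<Rightarrow> int \<Rightarrow> 'a \<Rightarrow>
   (nat \<Rightarrow> 'a) \<Rightarrow> (nat \<Rightarrow> 'b) \<Rightarrow> (nat \<Rightarrow> real ^ 'q) \<Rightarrow> real ^ 'n \<Rightarrow> nat \<Rightarrow> real ^ 'n" where
  "cl_state A B E K f T \<tau>0 \<sigma>0 r s w x0 0 = x0"
| "cl_state A B E K f T \<tau>0 \<sigma>0 r s w x0 (Suc k) =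
    (A (r k) + B (r k) ** K (obs_mode f \<tau>0 \<sigma>0 r s k) (obs_age f T \<tau>0 s k))
      *v cl_state A B E K f T \<tau>0 \<sigma>0 r s w x0 k + E (r k) *v w k"

definition cl_output ::
  "('a \<Rightarrow> real ^ 'n ^ 'n) \<Rightarrow> ('a \<Rightarrow> real ^ 'm ^ 'n) \<Rightarrow> ('a \<Rightarrow> real ^ 'n ^ 'l) \<Rightarrow>
   ('a \<Rightarrow> real ^ 'm ^ 'l) \<Rightarrow> ('a \<Rightarrow> real ^ 'q ^ 'n) \<Rightarrow>
   ('a \<Rightarrow> nat \<Rightarrow> real ^ 'n ^ 'm) \<Rightarrow> ('b \<Rightarrow> bool) \<Rightarrow> nat \<Rightarrow> int \<Rightarrow> 'a \<Rightarrow>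
   (nat \<Rightarrow> 'a) \<Rightarrow> (nat \<Rightarrow> 'b) \<Rightarrow> (nat \<Rightarrow> real ^ 'q) \<Rightarrow> real ^ 'n \<Rightarrow> nat \<Rightarrow> real ^ 'l" where
  "cl_output A B C D E K f T \<tau>0 \<sigma>0 r s w x0 k =
    (C (r k) + D (r k) ** K (obs_mode f \<tau>0 \<sigma>0 r s k) (obs_age f T \<tau>0 s k))
      *v cl_state A B E K f T \<tau>0 \<sigma>0 r s w x0 k"

section \<open>Mean square stability and the H-infinity norm\<close>

text \<open>Here \<open>r\<close>, \<open>s\<close> are the families of processes of \<^const>\<open>mode_processes\<close>.  Second moments are
  taken in \<open>ennreal\<close>, so that no integrability or summability is presupposed.\<close>

definition mean_square_stable ::
  "('a::finite \<Rightarrow> real ^ 'n ^ 'n) \<Rightarrow> ('a \<Rightarrow> real ^ 'm ^ 'n) \<Rightarrow> ('a \<Rightarrow> real ^ 'q ^ 'n) \<Rightarrow>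
   ('a \<Rightarrow> nat \<Rightarrow> real ^ 'n ^ 'm) \<Rightarrow> ('b::finite \<Rightarrow> bool) \<Rightarrow> nat \<Rightarrow>
   ('a \<Rightarrow> 'b \<Rightarrow> 'w measure) \<Rightarrow> ('a \<Rightarrow> 'b \<Rightarrow> nat \<Rightarrow> 'w \<Rightarrow> 'a) \<Rightarrow>
   ('a \<Rightarrow> 'b \<Rightarrow> nat \<Rightarrow> 'w \<Rightarrow> 'b) \<Rightarrow> bool" where
  "mean_square_stable A B E K f T \<Omega> r s \<longleftrightarrow>
    (\<exists>c>0. \<exists>d::real. 0 \<le> d \<and> d < 1 \<and>
      (\<forall>x0 r0 s0 \<sigma>0 \<rho>0 \<tau>0 k.
         (r0, s0, \<sigma>0, \<rho>0) \<in> xstates f T \<longrightarrow> initial_time f T (r0, s0, \<sigma>0, \<rho>0) \<tau>0 \<longrightarrow>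
         (\<integral>\<^sup>+ \<omega>. ennreal ((norm (cl_state A B E K f T \<tau>0 \<sigma>0
              (\<lambda>j. r r0 s0 j \<omega>) (\<lambda>j. s r0 s0 j \<omega>) (\<lambda>_. 0) x0 k))\<^sup>2) \<partial>\<Omega> r0 s0)
           \<le> ennreal (c * d ^ k * (norm x0)\<^sup>2)))"

definition history ::
  "'w measure \<Rightarrow> (nat \<Rightarrow> 'w \<Rightarrow> 'a) \<Rightarrow> (nat \<Rightarrow> 'w \<Rightarrow> 'b) \<Rightarrow> nat \<Rightarrow> 'w measure" where
  "history \<Omega> \<xi> \<eta> k = sigma (space \<Omega>)
    ({\<xi> j -` S \<inter> space \<Omega> | j S. j \<le> k} \<union> {\<eta> j -` S \<inter> space \<Omega> | j S. j \<le> k})"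

definition l2_sq :: "'w measure \<Rightarrow> (nat \<Rightarrow> 'w \<Rightarrow> real ^ 'd) \<Rightarrow> ennreal" where
  "l2_sq \<Omega> h = (\<Sum>k. \<integral>\<^sup>+ \<omega>. ennreal ((norm (h k \<omega>))\<^sup>2) \<partial>\<Omega>)"

definition l2_norm :: "'w measure \<Rightarrow> (nat \<Rightarrow> 'w \<Rightarrow> real ^ 'd) \<Rightarrow> ennreal" where
  "l2_norm \<Omega> h = (if l2_sq \<Omega> h = \<infinity> then \<infinity> else ennreal (sqrt (enn2real (l2_sq \<Omega> h))))"

definition l2_space ::
  "'w measure \<Rightarrow> (nat \<Rightarrow> 'w \<Rightarrow> 'a) \<Rightarrow> (nat \<Rightarrow> 'w \<Rightarrow> 'b) \<Rightarrow> (nat \<Rightarrow> 'w \<Rightarrow> real ^ 'd) set" where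
  "l2_space \<Omega> \<xi> \<eta> =
    {h. (\<forall>k. h k \<in> borel_measurable (history \<Omega> \<xi> \<eta> k)) \<and> l2_sq \<Omega> h < \<infinity>}"

text \<open>As usual for \<open>\<ell>\<^sup>2\<close>, processes are identified when equal almost surely, so a disturbance is
  nonzero iff its norm is.\<close>

definition Hinf_norm ::
  "('a::finite \<Rightarrow> real ^ 'n ^ 'n) \<Rightarrow> ('a \<Rightarrow> real ^ 'm ^ 'n) \<Rightarrow> ('a \<Rightarrow> real ^ 'n ^ 'l) \<Rightarrow>
   ('a \<Rightarrow> real ^ 'm ^ 'l) \<Rightarrow> ('a \<Rightarrow> real ^ 'q ^ 'n) \<Rightarrow>
   ('a \<Rightarrow> nat \<Rightarrow> real ^ 'n ^ 'm) \<Rightarrow> ('b::finite \<Rightarrow> bool) \<Rightarrow> nat \<Rightarrow>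
   ('a \<Rightarrow> 'b \<Rightarrow> 'w measure) \<Rightarrow> ('a \<Rightarrow> 'b \<Rightarrow> nat \<Rightarrow> 'w \<Rightarrow> 'a) \<Rightarrow>
   ('a \<Rightarrow> 'b \<Rightarrow> nat \<Rightarrow> 'w \<Rightarrow> 'b) \<Rightarrow> ennreal" where
  "Hinf_norm A B C D E K f T \<Omega> r s =
    Sup {l2_norm (\<Omega> r0 s0)
           (\<lambda>k \<omega>. cl_output A B C D E K f T \<tau>0 \<sigma>0
              (\<lambda>j. r r0 s0 j \<omega>) (\<lambda>j. s r0 s0 j \<omega>) (\<lambda>j. w j \<omega>) 0 k)
         / l2_norm (\<Omega> r0 s0) w
        | r0 s0 \<sigma>0 \<rho>0 \<tau>0 w.
          (r0, s0, \<sigma>0, \<rho>0) \<in> xstates f T \<and> initial_time f T (r0, s0, \<sigma>0, \<rho>0) \<tau>0 \<and>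
          w \<in> l2_space (\<Omega> r0 s0) (r r0 s0) (s r0 s0) \<and> l2_norm (\<Omega> r0 s0) w \<noteq> 0}"

end

theory Submission
  imports Defs
begin

text \<open>
  The storage function is \<open>V \<chi> x = x \<bullet> X\<^sub>\<chi>\<inverse> x\<close>.  Testing the first inequality with the vector
  \<open>(G\<inverse> x, w, - H\<inverse> y, - z)\<close>, where \<open>y = (A + B K) x + E w\<close> and \<open>z = (C + D K) x\<close>, and the second
  one with \<open>(b, - X\<inverse> H b)\<close>, where \<open>b = - H\<inverse> y\<close>, gives the strict dissipation inequality
  \<open>(\<Sum>\<chi>'. p\<^sub>\<chi>\<^sub>\<chi>' V \<chi>' y) + \<parallel>z\<parallel>\<^sup>2 < V \<chi> x + g \<parallel>w\<parallel>\<^sup>2\<close> for \<open>(x, w) \<noteq> 0\<close>.  All its terms are quadratic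
  forms, so compactness of the unit sphere leaves a margin \<open>\<epsilon> (\<parallel>x\<parallel>\<^sup>2 + \<parallel>w\<parallel>\<^sup>2)\<close>, uniformly in the
  finitely many extended states.  Along the closed loop this makes the expected storage decay
  geometrically when \<open>w = 0\<close>, and summing it over time bounds the squared gain by \<open>g - \<epsilon>\<close>.  No
  conditional expectations are needed: everything known at time \<open>k\<close> is a function of the first
  \<open>k + 1\<close> values of the two chains, hence a step function on finitely many cylinder sets.
\<close>

section \<open>Block matrices and definite forms\<close>

text \<open>Block vectors over a sum index type. Nested to the right, as in
  \<open>join a (join b (join c d))\<close>, they match the block pattern of
  \<open>sym_block4\<close>.\<close>

definition join :: "real ^ 'a \<Rightarrow> real ^ 'b \<Rightarrow> real ^ ('a + 'b)" where
  "join u v = (\<chi> i. case i of Inl i' \<Rightarrow> u $ i' | Inr i' \<Rightarrow> v $ i')"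

lemma sum_UNIV_sum:
  fixes h :: "'a::finite + 'b::finite \<Rightarrow> 'c::comm_monoid_add"
  shows "(\<Sum>i\<in>UNIV. h i) = (\<Sum>i\<in>UNIV. h (Inl i)) + (\<Sum>i\<in>UNIV. h (Inr i))"
  by (simp add: UNIV_Plus_UNIV[symmetric] sum.Plus del: UNIV_Plus_UNIV)

lemma inner_join [simp]: "join a b \<bullet> join c d = a \<bullet> c + b \<bullet> d"
  by (simp add: inner_vec_def sum_UNIV_sum join_def)

lemma join_eq_0_iff [simp]: "join a b = 0 \<longleftrightarrow> a = 0 \<and> b = 0"
  by (auto simp: vec_eq_iff join_def split: sum.splits)

lemma stack_mult_vec [simp]: "stack S1 S2 *v a = join (S1 *v a) (S2 *v a)"
  by (auto simp: vec_eq_iff join_def stack_def matrix_vector_mult_def split: sum.splits)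

lemma sym_block2_mult_vec:
  "sym_block2 S11 S21 S22 *v join a b = join (S11 *v a + transpose S21 *v b) (S21 *v a + S22 *v b)"
  by (auto simp: vec_eq_iff join_def sym_block2_def matrix_vector_mult_def sum_UNIV_sum split: sum.splits)

lemma inner_vector_matrix_mult: "(a::real^'n) \<bullet> (b v* S) = (b::real^'m) \<bullet> (S *v a)"
  by (metis dot_lmul_matrix inner_commute)

lemma quadratic_form_sym_block2:
  "join a b \<bullet> (sym_block2 S11 S21 S22 *v join a b)
     = a \<bullet> (S11 *v a) + 2 * (b \<bullet> (S21 *v a)) + b \<bullet> (S22 *v b)"
  by (simp add: sym_block2_mult_vec inner_add_right inner_vector_matrix_mult)

lemma quadratic_form_sym_block4:
  "join a (join b (join c d)) \<bullet>
     (sym_block4 S11 S21 S22 S31 S32 S33 S41 S42 S43 S44 *v join a (join b (join c d)))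
   = a \<bullet> (S11 *v a) + b \<bullet> (S22 *v b) + c \<bullet> (S33 *v c) + d \<bullet> (S44 *v d)
     + 2 * (b \<bullet> (S21 *v a) + c \<bullet> (S31 *v a) + d \<bullet> (S41 *v a)
       + c \<bullet> (S32 *v b) + d \<bullet> (S42 *v b) + d \<bullet> (S43 *v c))"
  by (simp add: sym_block4_def quadratic_form_sym_block2)

text \<open>Restriction of the form to vectors whose upper part is zero. This is how positive
  definiteness of each \<open>X c\<close> is read off from the second matrix inequality.\<close>

lemma pos_def_sym_block2_lower:
  assumes "pos_def (sym_block2 S11 S21 S22)"
  shows "pos_def S22"
proof -
  have "transpose S22 $ i $ j = S22 $ i $ j" for i j
  proof -
    have "transpose (sym_block2 S11 S21 S22) $ Inr i $ Inr j = sym_block2 S11 S21 S22 $ Inr i $ Inr j"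
      using assms by (simp add: pos_def_def)
    then show ?thesis by (simp add: sym_block2_def transpose_def)
  qed
  moreover have "b \<bullet> (S22 *v b) > 0" if "b \<noteq> 0" for b
    using assms that quadratic_form_sym_block2[of 0 b S11 S21 S22]
    by (auto simp: pos_def_def dest: spec[of _ "join 0 b"])
  ultimately show ?thesis by (auto simp: pos_def_def vec_eq_iff)
qed

text \<open>A positive form forces a trivial kernel, and a square matrix with trivial kernel is
  invertible. Besides symmetric matrices this covers \<open>G\<close> and \<open>H\<close>, which
  are in general not symmetric.\<close>

lemma invertible_if_quadratic_form_pos:
  fixes S :: "real ^ 'n ^ 'n"
  assumes "\<And>v. v \<noteq> 0 \<Longrightarrow> v \<bullet> (S *v v) > 0"
  shows "S *v (matrix_inv S *v v) = v"
proof -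
  have "S *v v = 0 \<Longrightarrow> v = 0" for v
    using assms[of v] by fastforce
  then have "invertible S"
    by (metis invertible_left_inverse matrix_left_invertible_ker)
  then have "S ** matrix_inv S = mat 1"
    unfolding matrix_inv_def invertible_def by (rule someI2_ex) blast
  then show ?thesis
    by (metis matrix_vector_mul_assoc matrix_vector_mul_lid)
qed

text \<open>Completing the square: with \<open>e\<close> the solution of \<open>S *v e = x\<close>,
  the gap between the two sides is the form of \<open>S\<close> at \<open>u - e\<close>. It replaces
  the usual matrix bound of \<open>G + transpose G - X\<close> by a product with the inverse of
  \<open>X\<close>.\<close>

lemma pos_def_inv_Fenchel:
  assumes "pos_def S"
  shows "2 * (u \<bullet> x) - u \<bullet> (S *v u) \<le> x \<bullet> (matrix_inv S *v x)"
proof -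
  define e where "e = matrix_inv S *v x"
  have Se: "S *v e = x"
    unfolding e_def by (rule invertible_if_quadratic_form_pos) (use assms in \<open>auto simp: pos_def_def\<close>)
  have "(u - e) \<bullet> (S *v (u - e)) \<ge> 0"
    using assms unfolding pos_def_def by (cases "u - e = 0") (auto intro: less_imp_le)
  moreover have "e \<bullet> (S *v u) = u \<bullet> x"
    using assms inner_vector_matrix_mult[of e u S] Se transpose_matrix_vector[of S u]
    by (simp add: pos_def_def)
  ultimately show ?thesis
    by (simp add: matrix_vector_mult_diff_distrib inner_diff_left inner_diff_right Se)
       (simp add: e_def inner_commute)
qed

lemma pos_def_inv_pos:
  assumes "pos_def S" "x \<noteq> 0"
  shows "x \<bullet> (matrix_inv S *v x) > 0"
proof -
  define e where "e = matrix_inv S *v x"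
  have Se: "S *v e = x"
    unfolding e_def by (rule invertible_if_quadratic_form_pos) (use assms in \<open>auto simp: pos_def_def\<close>)
  then have "e \<noteq> 0" using assms by auto
  then have "e \<bullet> (S *v e) > 0" using assms by (auto simp: pos_def_def)
  then show ?thesis unfolding Se by (simp add: e_def inner_commute)
qed

text \<open>The vector tested is the minimiser in the lower block: at \<open>join b (- e)\<close>
  the cross term and the lower term combine to minus the left-hand side.\<close>

lemma pos_def_sym_block2_Schur:
  assumes "pos_def (sym_block2 S11 S21 S22)"
  shows "(S21 *v b) \<bullet> (matrix_inv S22 *v (S21 *v b)) \<le> b \<bullet> (S11 *v b)"
proof -
  define e where "e = matrix_inv S22 *v (S21 *v b)"
  have Se: "S22 *v e = S21 *v b"
    unfolding e_def by (rule invertible_if_quadratic_form_pos)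
      (use pos_def_sym_block2_lower[OF assms] in \<open>auto simp: pos_def_def\<close>)
  have "join b (- e) \<bullet> (sym_block2 S11 S21 S22 *v join b (- e)) \<ge> 0"
    using assms unfolding pos_def_def
    by (cases "join b (- e) = 0") (auto intro: less_imp_le simp del: join_eq_0_iff)
  then show ?thesis
    using Se by (simp add: quadratic_form_sym_block2 linear_neg[OF matrix_vector_mul_linear])
      (simp add: e_def inner_commute)
qed

section \<open>Margins of positive forms and dissipation at a single extended state\<close>

lemma quadratic_growth:
  fixes Q :: "'e::euclidean_space \<Rightarrow> real"
  assumes "continuous_on UNIV Q"
    and hom: "\<And>c v. Q (c *\<^sub>R v) = c\<^sup>2 * Q v"
    and pos: "\<And>v. v \<noteq> 0 \<Longrightarrow> Q v > 0"
  obtains \<epsilon> where "\<epsilon> > 0" "\<And>v. \<epsilon> * (norm v)\<^sup>2 \<le> Q v"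
proof -
  have "sphere (0::'e) 1 \<noteq> {}" using vector_choose_size[of 1] by auto
  \<comment> \<open>The minimum over the compact unit sphere serves as the margin; homogeneity
    carries it to all vectors.\<close>
  then obtain u where u: "norm u = 1" "\<And>v. norm v = 1 \<Longrightarrow> Q u \<le> Q v"
    using continuous_attains_inf[of "sphere (0::'e) 1" Q] continuous_on_subset[OF assms(1)]
    by auto
  have "Q u * (norm v)\<^sup>2 \<le> Q v" for v
  proof (cases "v = 0")
    case True
    then show ?thesis using hom[of 0 v] by simp
  next
    case False
    have "Q v = Q (norm v *\<^sub>R (v /\<^sub>R norm v))" using False by simp
    also have "\<dots> = (norm v)\<^sup>2 * Q (v /\<^sub>R norm v)" by (rule hom)
    also have "\<dots> \<ge> (norm v)\<^sup>2 * Q u" using u(2) False by (intro mult_left_mono) auto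
    finally show ?thesis by (simp add: mult.commute)
  qed
  moreover have "Q u > 0" using pos[of u] u(1) by (cases "u = 0") auto
  ultimately show ?thesis using that by blast
qed

text \<open>Constants found separately for finitely many states are replaced by their minimum, which
  \<open>mono\<close> permits.\<close>

lemma finite_uniform_pos:
  fixes P :: "'c \<Rightarrow> real \<Rightarrow> bool"
  assumes "finite S" "\<And>c. c \<in> S \<Longrightarrow> \<exists>\<epsilon>>0. P c \<epsilon>"
    and mono: "\<And>c \<epsilon> \<epsilon>'. c \<in> S \<Longrightarrow> P c \<epsilon> \<Longrightarrow> 0 < \<epsilon>' \<Longrightarrow> \<epsilon>' \<le> \<epsilon> \<Longrightarrow> P c \<epsilon>'"
  obtains \<epsilon> where "\<epsilon> > 0" "\<And>c. c \<in> S \<Longrightarrow> P c \<epsilon>"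
proof -
  obtain \<epsilon> where \<epsilon>: "\<And>c. c \<in> S \<Longrightarrow> \<epsilon> c > 0 \<and> P c (\<epsilon> c)" using assms(2) by metis
  \<comment> \<open>The extra element 1 gives \<open>Min\<close> a nonempty argument even when
    \<open>S\<close> is empty.\<close>
  define e where "e = Min (insert 1 (\<epsilon> ` S))"
  have "e > 0" using \<epsilon> assms(1) by (auto simp: e_def)
  moreover have "P c e" if "c \<in> S" for c
  proof (rule mono[OF that])
    show "P c (\<epsilon> c)" using \<epsilon>[OF that] by blast
    show "e \<le> \<epsilon> c" unfolding e_def using assms(1) that by (intro Min_le) auto
  qed fact
  ultimately show ?thesis using that by blast
qed

text \<open>\<open>SS\<close> abstracts the expected storage after one step. It is linked to the
  inequality only through its bound by the form of \<open>FZ\<close>, so the statement is pure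
  matrix algebra for one fixed extended state.\<close>

lemma LMI_dissipation:
  fixes A G X H FZ :: "real^'n^'n" and B :: "real^'m^'n" and C :: "real^'n^'l" and D :: "real^'m^'l"
    and E :: "real^'q^'n" and F :: "real^'n^'m"
    and SS :: "real^'n \<Rightarrow> real"
  assumes lmi: "pos_def (sym_block4 (G + transpose G - X) 0 (g *\<^sub>R mat 1)
        (A ** G + B ** F) E (H + transpose H - FZ) (C ** G + D ** F) 0 0 (mat 1))"
    and X: "pos_def X"
    and FZ: "\<And>b. SS (H *v b) \<le> b \<bullet> (FZ *v b)"
    and SS0: "\<And>v. SS v \<ge> 0" and SSm: "\<And>v. SS (- v) = SS v"
    and xw: "(x, w) \<noteq> 0"
  shows "SS ((A + B ** (F ** matrix_inv G)) *v x + E *v w)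
      + (norm ((C + D ** (F ** matrix_inv G)) *v x))\<^sup>2
    < x \<bullet> (matrix_inv X *v x) + g * (norm w)\<^sup>2"
proof -
  define AG where "AG = A ** G + B ** F"
  define CG where "CG = C ** G + D ** F"
  note lmi = lmi[folded AG_def CG_def]
  have pos: "a \<bullet> ((G + transpose G - X) *v a) + g * (norm w)\<^sup>2 + b \<bullet> ((H + transpose H - FZ) *v b)
      + (norm c)\<^sup>2 + 2 * (b \<bullet> (AG *v a) + c \<bullet> (CG *v a) + b \<bullet> (E *v w)) > 0"
    if "a \<noteq> 0 \<or> w \<noteq> 0 \<or> b \<noteq> 0 \<or> c \<noteq> 0" for a w b c
  proof -
    have "join a (join w (join b c)) \<noteq> 0" using that by auto
    then have "0 < join a (join w (join b c)) \<bullet> (sym_block4 (G + transpose G - X) 0 (g *\<^sub>R mat 1)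
        AG E (H + transpose H - FZ) CG 0 0 (mat 1) *v join a (join w (join b c)))"
      using lmi by (auto simp: pos_def_def)
    then show ?thesis
      unfolding quadratic_form_sym_block4
      by (simp add: scaleR_matrix_vector_assoc[symmetric] power2_norm_eq_inner)
  qed
  have symq: "a \<bullet> ((S + transpose S - R) *v a) = 2 * (a \<bullet> (S *v a)) - a \<bullet> (R *v a)"
    for a :: "real^'n" and S R
    by (simp add: matrix_vector_mult_diff_rdistrib matrix_vector_mult_add_rdistrib inner_diff_right
        inner_add_right inner_vector_matrix_mult)
  \<comment> \<open>The first diagonal block says that twice the form of \<open>G\<close> exceeds
    the positive form of \<open>X\<close>.\<close>
  have G: "G *v (matrix_inv G *v v) = v" for v
  proof (rule invertible_if_quadratic_form_pos)
    fix v :: "real^'n" assume "v \<noteq> 0"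
    then have "v \<bullet> (X *v v) > 0" using X by (simp add: pos_def_def)
    moreover have "v \<bullet> ((G + transpose G - X) *v v) > 0"
      using pos[of v 0 0 0] \<open>v \<noteq> 0\<close> by simp
    ultimately show "v \<bullet> (G *v v) > 0" by (simp add: symq)
  qed
  \<comment> \<open>The third diagonal block says that twice the form of \<open>H\<close> exceeds
    the form of \<open>FZ\<close>, which is nonnegative because it dominates
    \<open>SS\<close>.\<close>
  have H: "H *v (matrix_inv H *v v) = v" for v
  proof (rule invertible_if_quadratic_form_pos)
    fix v :: "real^'n" assume "v \<noteq> 0"
    then have "v \<bullet> ((H + transpose H - FZ) *v v) > 0" using pos[of 0 0 v 0] by simp
    moreover have "v \<bullet> (FZ *v v) \<ge> 0" using FZ[of v] SS0[of "H *v v"] by linarith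
    ultimately show "v \<bullet> (H *v v) > 0" by (simp add: symq)
  qed
  define a where "a = matrix_inv G *v x"
  define y where "y = (A + B ** (F ** matrix_inv G)) *v x + E *v w"
  define z where "z = (C + D ** (F ** matrix_inv G)) *v x"
  \<comment> \<open>The sign is chosen so that the form of \<open>H + transpose H\<close> at
    \<open>b\<close> contributes \<open>- 2 * (b \<bullet> y)\<close>, which cancels the cross terms
    of \<open>b\<close> with \<open>AG *v a\<close> and \<open>E *v w\<close>. The block
    \<open>- z\<close> likewise leaves exactly minus the squared norm of \<open>z\<close>.\<close>
  define b where "b = - (matrix_inv H *v y)"
  have a: "G *v a = x" unfolding a_def by (rule G)
  have b: "H *v b = - y" unfolding b_def by (simp add: linear_neg[OF matrix_vector_mul_linear] H)
  have y: "y = AG *v a + E *v w" and z: "z = CG *v a"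
    by (simp_all add: y_def z_def AG_def CG_def matrix_vector_mult_add_rdistrib
        matrix_vector_mul_assoc[symmetric] a a_def[symmetric])
  have "a \<noteq> 0 \<or> w \<noteq> 0" using xw a by (auto simp: zero_prod_def)
  \<comment> \<open>Were both zero, \<open>x = G *v a\<close> would vanish as well, against
    \<open>xw\<close>.\<close>
  then have "a \<bullet> ((G + transpose G - X) *v a) + g * (norm w)\<^sup>2 + b \<bullet> ((H + transpose H - FZ) *v b)
      + (norm (- z))\<^sup>2 + 2 * (b \<bullet> (AG *v a) + (- z) \<bullet> (CG *v a) + b \<bullet> (E *v w)) > 0"
    by (intro pos) auto
  then have "2 * (a \<bullet> x) - a \<bullet> (X *v a) + g * (norm w)\<^sup>2 - b \<bullet> (FZ *v b) - (norm z)\<^sup>2 > 0"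
    by (simp only: symq a b z[symmetric]) (simp add: y inner_add_right power2_norm_eq_inner algebra_simps)
  moreover have "SS y \<le> b \<bullet> (FZ *v b)" using FZ[of b] by (simp add: b SSm)
  moreover have "2 * (a \<bullet> x) - a \<bullet> (X *v a) \<le> x \<bullet> (matrix_inv X *v x)"
    using X by (rule pos_def_inv_Fenchel)
  ultimately show ?thesis unfolding y_def[symmetric] z_def[symmetric] by linarith
qed

section \<open>Recursion for the extended state\<close>

lemma Inf_enat_in: "(S::enat set) \<noteq> {} \<Longrightarrow> Inf S \<in> S"
  by (simp add: Inf_enat_def) (metis LeastI ex_in_conv)

lemma obs_time_sound:
  assumes "obs_time f s i = enat j"
  shows "f (s j)"
proof -
  have "f (s j)" if "Inf {enat k | k. P k \<and> f (s k)} = enat j" for P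
  proof -
    have "{enat k | k. P k \<and> f (s k)} \<noteq> {}" using that by (metis (lifting) Inf_enat_def enat.distinct(1))
    from Inf_enat_in[OF this] show ?thesis using that by auto
  qed
  \<comment> \<open>The two predicates are those of the base and the successor clause of
    \<open>obs_time\<close>; \<open>i - 1\<close> is the predecessor needed in the second.\<close>
  note * = this[of "\<lambda>_. True"] this[of "\<lambda>k. obs_time f s (i - 1) < enat k"]
  show ?thesis using assms * by (cases i) auto
qed

text \<open>Strong induction on the instant: the latest earlier instant satisfying \<open>f\<close>
  is some observation time, and \<open>j\<close> is then the next one.\<close>

lemma obs_time_complete:
  assumes "f (s j)"
  shows "\<exists>i. obs_time f s i = enat j"
  using assms
proof (induction j rule: less_induct)
  case (less j)
  show ?case
  proof (cases "\<exists>j'<j. f (s j')")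
    case False
    then have "obs_time f s 0 = enat j" using less.prems
      by (auto intro!: antisym Inf_lower Inf_greatest simp: not_less)
    then show ?thesis by blast
  next
    case True
    define j' where "j' = Max {j'. j' < j \<and> f (s j')}"
    have j': "j' < j" "f (s j')" "\<And>k. k < j \<Longrightarrow> f (s k) \<Longrightarrow> k \<le> j'"
      using Max_in[of "{j'. j' < j \<and> f (s j')}"] True by (auto simp: j'_def)
    then obtain i where "obs_time f s i = enat j'" using less.IH by blast
    then have "obs_time f s (Suc i) = enat j" using less.prems j'
      by (auto intro!: antisym Inf_lower Inf_greatest) (meson not_le)
    then show ?thesis by blast
  qed
qed

lemma obs_time_eq_iff: "(\<exists>i. obs_time f s i = enat j) \<longleftrightarrow> f (s j)"
  using obs_time_sound obs_time_complete by metis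

lemma obs_time_0_le_iff: "obs_time f s 0 \<le> enat k \<longleftrightarrow> (\<exists>j\<le>k. f (s j))"
proof
  assume *: "obs_time f s 0 \<le> enat k"
  then obtain j where j: "obs_time f s 0 = enat j" by (cases "obs_time f s 0") auto
  then show "\<exists>j\<le>k. f (s j)" using obs_time_sound[OF j] * j by auto
next
  assume "\<exists>j\<le>k. f (s j)"
  then obtain j where "j \<le> k" "f (s j)" by blast
  then show "obs_time f s 0 \<le> enat k" by (auto intro!: Inf_lower2[of "enat j"])
qed

text \<open>Removes the enumeration of observation times: from here on only the instants satisfying
  \<open>f\<close> matter.\<close>

lemma last_obs_eq:
  "last_obs f \<tau>0 s k = (if \<exists>j\<le>k. f (s j) then int (Max {j. j \<le> k \<and> f (s j)}) else \<tau>0)"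
  by (simp add: last_obs_def obs_time_eq_iff obs_time_0_le_iff del: obs_time.simps) blast

lemma last_obs_observed: "f (s k) \<Longrightarrow> last_obs f \<tau>0 s k = int k"
  by (auto simp: last_obs_eq intro!: Max_eqI)

lemma last_obs_Suc_unobserved:
  "\<not> f (s (Suc k)) \<Longrightarrow> last_obs f \<tau>0 s (Suc k) = last_obs f \<tau>0 s k"
  by (simp add: last_obs_eq le_Suc_eq conj_disj_distribR ex_disj_distrib cong: conj_cong)

lemma obs_mode_observed: "f (s k) \<Longrightarrow> obs_mode f \<tau>0 \<sigma>0 r s k = r k"
  by (auto simp: obs_mode_def last_obs_observed obs_time_0_le_iff simp del: obs_time.simps)

lemma obs_mode_Suc_unobserved:
  "\<not> f (s (Suc k)) \<Longrightarrow> obs_mode f \<tau>0 \<sigma>0 r s (Suc k) = obs_mode f \<tau>0 \<sigma>0 r s k"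
  by (auto simp: obs_mode_def last_obs_Suc_unobserved obs_time_0_le_iff le_Suc_eq
      simp del: obs_time.simps)

lemma obs_age_observed: "f (s k) \<Longrightarrow> obs_age f T \<tau>0 s k = 1"
  by (simp add: obs_age_def last_obs_observed)

text \<open>Ages run cyclically through 1 to \<open>T\<close>: the shift by one in
  \<open>obs_age\<close> turns the residue update into \<open>mod T + 1\<close>, which sends
  \<open>T\<close> back to 1. The computation is done in the integers because the initial
  observation time may be negative.\<close>

lemma obs_age_Suc_unobserved:
  assumes "\<not> f (s (Suc k))" "T > 0"
  shows "obs_age f T \<tau>0 s (Suc k) = obs_age f T \<tau>0 s k mod T + 1"
proof -
  define d where "d = int k - last_obs f \<tau>0 s k"
  have "int (nat ((d + 1) mod int T)) = int ((nat (d mod int T) + 1) mod T)"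
    using assms(2) by (simp add: zmod_int mod_simps add.commute)
  then show ?thesis
    using assms unfolding obs_age_def last_obs_Suc_unobserved[of f s k, OF assms(1)]
    by (simp add: d_def algebra_simps)
qed

definition ext_state ::
  "('b \<Rightarrow> bool) \<Rightarrow> nat \<Rightarrow> int \<Rightarrow> 'a \<Rightarrow> (nat \<Rightarrow> 'a) \<Rightarrow> (nat \<Rightarrow> 'b) \<Rightarrow> nat \<Rightarrow> ('a, 'b) xstate" where
  "ext_state f T \<tau>0 \<sigma>0 r s k = (r k, s k, obs_mode f \<tau>0 \<sigma>0 r s k, obs_age f T \<tau>0 s k)"

text \<open>Given the new values of the two chains, the rest of the extended state is updated
  deterministically; all randomness of a transition sits in the pair of new values.\<close>

definition next_xstate ::
  "('b \<Rightarrow> bool) \<Rightarrow> nat \<Rightarrow> ('a, 'b) xstate \<Rightarrow> 'a \<Rightarrow> 'b \<Rightarrow> ('a, 'b) xstate" where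
  "next_xstate f T = (\<lambda>(\<alpha>, \<beta>, \<gamma>, \<delta>) \<alpha>' \<beta>'.
     if f \<beta>' then (\<alpha>', \<beta>', \<alpha>', 1) else (\<alpha>', \<beta>', \<gamma>, \<delta> mod T + 1))"

lemma ext_state_Suc:
  "T > 0 \<Longrightarrow> ext_state f T \<tau>0 \<sigma>0 r s (Suc k)
     = next_xstate f T (ext_state f T \<tau>0 \<sigma>0 r s k) (r (Suc k)) (s (Suc k))"
  by (simp add: ext_state_def next_xstate_def obs_mode_observed obs_mode_Suc_unobserved
      obs_age_observed obs_age_Suc_unobserved)

lemma ext_state_in_xstates: "T > 0 \<Longrightarrow> ext_state f T \<tau>0 \<sigma>0 r s k \<in> xstates f T"
  using pos_mod_bound[of "int T" "int k - last_obs f \<tau>0 s k"]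
  by (auto simp: ext_state_def xstates_def obs_mode_observed obs_age_observed)
     (auto simp: obs_age_def nat_less_iff Suc_le_eq)

text \<open>Causality: the extended state at time \<open>k\<close> sees only the values of the
  chains up to \<open>k\<close>. This makes it a function of finite paths.\<close>

lemma ext_state_cong:
  assumes "T > 0" "\<And>j. j \<le> k \<Longrightarrow> r j = r' j" "\<And>j. j \<le> k \<Longrightarrow> s j = s' j"
  shows "ext_state f T \<tau>0 \<sigma>0 r s k = ext_state f T \<tau>0 \<sigma>0 r' s' k"
  using assms(2,3)
proof (induction k)
  case 0
  then show ?case by (simp add: ext_state_def obs_mode_def obs_age_def last_obs_eq obs_time_0_le_iff
        cong: conj_cong del: obs_time.simps)
next
  case (Suc k)
  then show ?case by (simp add: ext_state_Suc assms(1))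
qed

lemma finite_xstates: "finite (xstates f T :: ('a::finite, 'b::finite) xstate set)"
  by (rule finite_subset[of _ "UNIV \<times> UNIV \<times> UNIV \<times> {1..T}"]) (auto simp: xstates_def)

lemma next_xstate_in_xstates: "T > 0 \<Longrightarrow> next_xstate f T c \<alpha>' \<beta>' \<in> xstates f T"
  by (auto simp: next_xstate_def xstates_def Suc_le_eq split: prod.splits)

text \<open>Since \<open>\<delta>' - 1\<close> lies below \<open>T\<close>, it is its own residue,
  so the congruence in \<open>xtrans\<close> selects a single successor age.\<close>

lemma age_step_iff:
  assumes "\<delta>' \<in> {1..T}"
  shows "(int \<delta>' - int \<delta> - 1) mod int T = 0 \<longleftrightarrow> \<delta>' = \<delta> mod T + 1"
proof -
  have "(int \<delta>' - int \<delta> - 1) mod int T = 0 \<longleftrightarrow> (int (\<delta>' - 1) - int \<delta>) mod int T = 0"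
    using assms by (simp add: of_nat_diff algebra_simps)
  also have "\<dots> \<longleftrightarrow> (\<delta>' - 1) mod T = \<delta> mod T"
    by (metis mod_eq_dvd_iff mod_eq_0_iff_dvd of_nat_eq_iff zmod_int)
  finally show ?thesis using assms by auto
qed

text \<open>A row of \<open>xtrans\<close> is supported on the image of the injective map taking new
  chain values to \<open>next_xstate\<close>, with weight
  \<open>p \<alpha> \<alpha>' * q \<beta> \<beta>'\<close> there. Sums over extended states thus
  become sums over new chain values.\<close>

lemma sum_xtrans:
  fixes h :: "('a::finite, 'b::finite) xstate \<Rightarrow> real"
  assumes "T > 0" "c = (\<alpha>, \<beta>, \<gamma>, \<delta>)"
  shows "(\<Sum>c'\<in>xstates f T. xtrans p q f T c c' * h c')
    = (\<Sum>(\<alpha>', \<beta>')\<in>UNIV. p \<alpha> \<alpha>' * q \<beta> \<beta>' * h (next_xstate f T c \<alpha>' \<beta>'))"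
proof -
  have 1: "xtrans p q f T c c' = 0" if "c' \<in> xstates f T - (\<lambda>(\<alpha>', \<beta>'). next_xstate f T c \<alpha>' \<beta>') ` UNIV" for c'
  proof -
    obtain a b g d where c': "c' = (a, b, g, d)" by (metis prod_cases4)
    have "c' \<noteq> next_xstate f T c a b" "d \<in> {1..T}" using that by (auto simp: c' xstates_def image_iff)
    then show ?thesis using age_step_iff[of d T \<delta>]
      by (auto simp: assms(2) c' next_xstate_def xtrans_def split: if_splits)
  qed
  have 2: "xtrans p q f T c (next_xstate f T c \<alpha>' \<beta>') = p \<alpha> \<alpha>' * q \<beta> \<beta>'" for \<alpha>' \<beta>'
    using age_step_iff[of "\<delta> mod T + 1" T \<delta>] assms(1)
    by (auto simp: assms(2) next_xstate_def xtrans_def Suc_le_eq)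
  have inj: "inj (\<lambda>(\<alpha>', \<beta>'). next_xstate f T c \<alpha>' \<beta>')"
    by (auto simp: inj_def assms(2) next_xstate_def split: if_splits)
  have "(\<Sum>c'\<in>xstates f T. xtrans p q f T c c' * h c')
    = (\<Sum>c'\<in>range (\<lambda>(\<alpha>', \<beta>'). next_xstate f T c \<alpha>' \<beta>'). xtrans p q f T c c' * h c')"
    using 1 assms(1) by (intro sum.mono_neutral_right) (auto simp: finite_xstates next_xstate_in_xstates)
  also have "\<dots> = (\<Sum>(\<alpha>', \<beta>')\<in>UNIV. p \<alpha> \<alpha>' * q \<beta> \<beta>' * h (next_xstate f T c \<alpha>' \<beta>'))"
    by (subst sum.reindex[OF inj]) (auto simp: 2 intro!: sum.cong)
  finally show ?thesis .
qed

section \<open>Expectations over the paths of the two chains\<close>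

lemma (in prob_space) markov_chain_path_Suc:
  fixes c :: "nat \<Rightarrow> 'c::finite"
  assumes "markov_chain M P c0 \<xi>"
  shows "\<P>(\<omega> in M. \<forall>j\<le>Suc k. \<xi> j \<omega> = c j) = \<P>(\<omega> in M. \<forall>j\<le>k. \<xi> j \<omega> = c j) * P (c k) (c (Suc k))"
proof -
  have [measurable]: "\<xi> j \<in> M \<rightarrow>\<^sub>M count_space UNIV" for j
    using assms by (auto simp: markov_chain_def)
  have ev: "{\<omega> \<in> space M. \<forall>j\<le>k. \<xi> j \<omega> = c j} \<in> events"
  proof -
    have "{\<omega> \<in> space M. \<forall>j\<in>{..k}. \<xi> j \<omega> = c j} \<in> events" by measurable
    then show ?thesis by (simp add: atMost_def)
  qed
  have eq: "{\<omega> \<in> space M. \<forall>j\<le>Suc k. \<xi> j \<omega> = c j}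
      = {\<omega> \<in> space M. \<xi> (Suc k) \<omega> = c (Suc k) \<and> (\<forall>j\<le>k. \<xi> j \<omega> = c j)}"
    by (auto simp: le_Suc_eq)
  show ?thesis
  proof (cases "\<P>(\<omega> in M. \<forall>j\<le>k. \<xi> j \<omega> = c j) > 0")
    case True
    then have "\<P>(\<omega> in M. \<xi> (Suc k) \<omega> = c (Suc k) \<bar> \<forall>j\<le>k. \<xi> j \<omega> = c j) = P (c k) (c (Suc k))"
      using assms by (auto simp: markov_chain_def)
    then show ?thesis using True unfolding eq by (simp add: cond_prob_def field_simps)
  next
    \<comment> \<open>The Markov property is silent about null pasts. Here the longer path event
      lies inside a null event, so both sides are zero.\<close>
    case False
    then have 0: "\<P>(\<omega> in M. \<forall>j\<le>k. \<xi> j \<omega> = c j) = 0" by (simp add: zero_less_measure_iff)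
    have "\<P>(\<omega> in M. \<forall>j\<le>Suc k. \<xi> j \<omega> = c j) \<le> \<P>(\<omega> in M. \<forall>j\<le>k. \<xi> j \<omega> = c j)"
      unfolding eq using ev by (intro finite_measure_mono) auto
    then show ?thesis using 0 by (simp add: measure_le_0_iff)
  qed
qed

lemma path_event_in_sigma_sets:
  fixes \<xi> :: "nat \<Rightarrow> 'd \<Rightarrow> 'c"
  shows "{\<omega> \<in> \<Omega>. \<forall>j\<le>k. \<xi> j \<omega> = c j}
    \<in> sigma_sets \<Omega> {\<xi> j -` S \<inter> \<Omega> | j S. True}" (is "_ \<in> sigma_sets _ ?G")
proof -
  interpret S: sigma_algebra "\<Omega>" "sigma_sets \<Omega> ?G"
    by (rule sigma_algebra_sigma_sets) blast
  have 1: "\<xi> j -` {c j} \<inter> \<Omega> \<in> sigma_sets \<Omega> ?G" for j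
    by (rule sigma_sets.Basic) blast
  have "(\<Inter>j\<in>{..k}. \<xi> j -` {c j} \<inter> \<Omega>) \<in> sigma_sets \<Omega> ?G"
    by (intro S.finite_INT 1) auto
  also have "(\<Inter>j\<in>{..k}. \<xi> j -` {c j} \<inter> \<Omega>) = {\<omega> \<in> \<Omega>. \<forall>j\<le>k. \<xi> j \<omega> = c j}"
    by blast
  finally show ?thesis .
qed

section \<open>Cylinder events for a pair of independent chains with fixed initial states\<close>

locale mode_chains = prob_space \<Omega>
  for \<Omega> :: "'w measure"
    and p :: "'a::finite \<Rightarrow> 'a \<Rightarrow> real" and q :: "'b::finite \<Rightarrow> 'b \<Rightarrow> real"
    and a0 :: 'a and b0 :: 'b
    and r :: "nat \<Rightarrow> 'w \<Rightarrow> 'a" and s :: "nat \<Rightarrow> 'w \<Rightarrow> 'b" +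
  assumes markov_r: "markov_chain \<Omega> p a0 r"
    and markov_s: "markov_chain \<Omega> q b0 s"
    and indep: "indep_processes \<Omega> r s"
begin

text \<open>Restriction makes a finite path an extensional function, so that \<open>paths k\<close>
  is finite and its cylinders partition the space.\<close>

definition path :: "nat \<Rightarrow> 'w \<Rightarrow> nat \<Rightarrow> 'a \<times> 'b" where
  "path k \<omega> = restrict (\<lambda>j. (r j \<omega>, s j \<omega>)) {..k}"

definition paths :: "nat \<Rightarrow> (nat \<Rightarrow> 'a \<times> 'b) set" where
  "paths k = {..k} \<rightarrow>\<^sub>E UNIV"

definition cyl :: "nat \<Rightarrow> (nat \<Rightarrow> 'a \<times> 'b) \<Rightarrow> 'w set" where
  "cyl k \<pi> = {\<omega> \<in> space \<Omega>. \<forall>j\<le>k. (r j \<omega>, s j \<omega>) = \<pi> j}"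

text \<open>The working form of being known at time \<open>k\<close>: constancy on every cylinder of
  length \<open>k + 1\<close>.\<close>

definition path_determined :: "nat \<Rightarrow> ('w \<Rightarrow> 'c) \<Rightarrow> bool" where
  "path_determined k \<phi> \<longleftrightarrow>
     (\<forall>\<omega>\<in>space \<Omega>. \<forall>\<omega>'\<in>space \<Omega>. (\<forall>j\<le>k. r j \<omega> = r j \<omega>' \<and> s j \<omega> = s j \<omega>') \<longrightarrow> \<phi> \<omega> = \<phi> \<omega>')"

lemma finite_paths: "finite (paths k)"
  by (simp add: paths_def finite_PiE)

lemma p_nonneg: "0 \<le> p a a'" and q_nonneg: "0 \<le> q b b'"
  using markov_r markov_s by (auto simp: markov_chain_def stochastic_matrix_def)

lemma random_variable_r [measurable]: "r k \<in> \<Omega> \<rightarrow>\<^sub>M count_space UNIV"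
  and random_variable_s [measurable]: "s k \<in> \<Omega> \<rightarrow>\<^sub>M count_space UNIV"
  using markov_r markov_s by (auto simp: markov_chain_def)

lemma cyl_measurable [measurable]: "cyl k \<pi> \<in> events"
proof -
  have "cyl k \<pi> = {\<omega> \<in> space \<Omega>. \<forall>j\<in>{..k}. r j \<omega> = fst (\<pi> j) \<and> s j \<omega> = snd (\<pi> j)}"
    by (auto simp: cyl_def prod_eq_iff)
  also have "\<dots> \<in> events" by measurable
  finally show ?thesis .
qed

text \<open>A cylinder is the intersection of a path event of \<open>r\<close> with one of
  \<open>s\<close>, and independence factorises its probability.\<close>

lemma prob_cyl:
  "prob (cyl k \<pi>) = \<P>(\<omega> in \<Omega>. \<forall>j\<le>k. r j \<omega> = fst (\<pi> j)) * \<P>(\<omega> in \<Omega>. \<forall>j\<le>k. s j \<omega> = snd (\<pi> j))"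
proof -
  have "cyl k \<pi> = {\<omega> \<in> space \<Omega>. \<forall>j\<le>k. r j \<omega> = fst (\<pi> j)} \<inter> {\<omega> \<in> space \<Omega>. \<forall>j\<le>k. s j \<omega> = snd (\<pi> j)}"
    by (auto simp: cyl_def prod_eq_iff)
  then show ?thesis
    by (rule ssubst)
      (rule indep_setD[OF indep[unfolded indep_processes_def]
        path_event_in_sigma_sets path_event_in_sigma_sets])
qed

lemma prob_cyl_Suc:
  "prob (cyl (Suc k) \<pi>)
     = prob (cyl k \<pi>) * (p (fst (\<pi> k)) (fst (\<pi> (Suc k))) * q (snd (\<pi> k)) (snd (\<pi> (Suc k))))"
  unfolding prob_cyl
    markov_chain_path_Suc[OF markov_r, of k "\<lambda>j. fst (\<pi> j)"]
    markov_chain_path_Suc[OF markov_s, of k "\<lambda>j. snd (\<pi> j)"]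
  by (simp only: mult_ac)

text \<open>Fixing the next pair of values gives the cylinder of the path extended by
  \<open>ab\<close>. Changing the path at \<open>Suc k\<close> does not affect
  \<open>cyl k\<close>.\<close>

lemma emeasure_cyl_next:
  "emeasure \<Omega> (cyl k \<pi> \<inter> {\<omega>. (r (Suc k) \<omega>, s (Suc k) \<omega>) = ab})
     = ennreal (p (fst (\<pi> k)) (fst ab) * q (snd (\<pi> k)) (snd ab)) * emeasure \<Omega> (cyl k \<pi>)"
proof -
  have "cyl k \<pi> \<inter> {\<omega>. (r (Suc k) \<omega>, s (Suc k) \<omega>) = ab} = cyl (Suc k) (\<pi>(Suc k := ab))"
    by (auto simp: cyl_def le_Suc_eq)
  moreover have "cyl k (\<pi>(Suc k := ab)) = cyl k \<pi>" by (auto simp: cyl_def)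
  ultimately show ?thesis using prob_cyl_Suc[of k "\<pi>(Suc k := ab)"]
    by (simp add: emeasure_eq_measure ennreal_mult'[symmetric] p_nonneg q_nonneg mult.commute)
qed

lemma in_cyl_iff:
  assumes "\<pi> \<in> paths k" "\<omega> \<in> space \<Omega>"
  shows "\<omega> \<in> cyl k \<pi> \<longleftrightarrow> \<pi> = path k \<omega>"
proof
  assume *: "\<omega> \<in> cyl k \<pi>"
  show "\<pi> = path k \<omega>"
  proof
    fix j
    show "\<pi> j = path k \<omega> j"
      using * assms(1) PiE_arb[of \<pi> "{..k}" "\<lambda>_. UNIV" j]
      by (cases "j \<le> k") (simp_all add: cyl_def path_def paths_def)
  qed
next
  assume "\<pi> = path k \<omega>"
  then show "\<omega> \<in> cyl k \<pi>" using assms(2) by (simp add: cyl_def path_def)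
qed

lemma path_in_paths: "path k \<omega> \<in> paths k"
  by (simp add: paths_def path_def)

lemma path_determinedD:
  assumes "path_determined k \<phi>" "\<omega> \<in> cyl k \<pi>" "\<omega>' \<in> cyl k \<pi>"
  shows "\<phi> \<omega> = \<phi> \<omega>'"
proof -
  have \<omega>: "\<omega> \<in> space \<Omega>" "\<omega>' \<in> space \<Omega>" using assms(2,3) unfolding cyl_def by blast+
  have "(\<forall>j\<le>k. r j \<omega> = r j \<omega>' \<and> s j \<omega> = s j \<omega>') \<longrightarrow> \<phi> \<omega> = \<phi> \<omega>'"
    by (rule assms(1)[unfolded path_determined_def, THEN bspec, THEN bspec, OF \<omega>])
  moreover have "r j \<omega> = r j \<omega>' \<and> s j \<omega> = s j \<omega>'" if "j \<le> k" for j
  proof -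
    have "(r j \<omega>, s j \<omega>) = \<pi> j" "(r j \<omega>', s j \<omega>') = \<pi> j"
      using assms(2,3) that unfolding cyl_def by blast+
    then have "(r j \<omega>, s j \<omega>) = (r j \<omega>', s j \<omega>')" by (rule trans[OF _ sym])
    then show ?thesis by (rule Pair_inject) (rule conjI)
  qed
  ultimately show ?thesis by blast
qed

text \<open>Exactly one cylinder contains the given point. On an empty cylinder the choice yields an
  arbitrary value, but there the indicator is zero.\<close>

lemma path_determined_simple:
  fixes \<phi> :: "'w \<Rightarrow> ennreal"
  assumes "path_determined k \<phi>" "\<omega> \<in> space \<Omega>"
  shows "\<phi> \<omega> = (\<Sum>\<pi>\<in>paths k. \<phi> (SOME \<omega>'. \<omega>' \<in> cyl k \<pi>) * indicator (cyl k \<pi>) \<omega>)"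
proof -
  have "\<phi> (SOME \<omega>'. \<omega>' \<in> cyl k \<pi>) * indicator (cyl k \<pi>) \<omega> = (if \<pi> = path k \<omega> then \<phi> \<omega> else 0)"
    if \<pi>: "\<pi> \<in> paths k" for \<pi>
  proof (cases "\<pi> = path k \<omega>")
    case True
    then have cyl: "\<omega> \<in> cyl k \<pi>" using in_cyl_iff[OF \<pi> assms(2)] by blast
    then have "(SOME \<omega>'. \<omega>' \<in> cyl k \<pi>) \<in> cyl k \<pi>" by (rule someI)
    from path_determinedD[OF assms(1) this cyl] cyl True show ?thesis by simp
  next
    case False
    then have "\<omega> \<notin> cyl k \<pi>" using in_cyl_iff[OF \<pi> assms(2)] by blast
    with False show ?thesis by simp
  qed
  then have "(\<Sum>\<pi>\<in>paths k. \<phi> (SOME \<omega>'. \<omega>' \<in> cyl k \<pi>) * indicator (cyl k \<pi>) \<omega>)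
    = (\<Sum>\<pi>\<in>paths k. if \<pi> = path k \<omega> then \<phi> \<omega> else 0)"
    by (rule sum.cong[OF refl])
  then show ?thesis by (simp add: finite_paths path_in_paths)
qed

lemma path_determined_measurable:
  fixes \<phi> :: "'w \<Rightarrow> ennreal"
  assumes "path_determined k \<phi>"
  shows "\<phi> \<in> borel_measurable \<Omega>"
proof -
  have "(\<lambda>\<omega>. \<Sum>\<pi>\<in>paths k. \<phi> (SOME \<omega>'. \<omega>' \<in> cyl k \<pi>) * indicator (cyl k \<pi>) \<omega>) \<in> borel_measurable \<Omega>"
    by measurable
  then show ?thesis
    using path_determined_simple[OF assms] by (simp cong: measurable_cong)
qed

text \<open>The Markov property for a function of the past and the next pair of values: expand over
  cylinders, replace each extended cylinder's measure by its transition weight, and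
  reassemble.\<close>

lemma nn_integral_next:
  fixes \<phi> :: "'a \<times> 'b \<Rightarrow> 'w \<Rightarrow> ennreal"
  assumes "\<And>ab. path_determined k (\<phi> ab)"
  shows "(\<integral>\<^sup>+\<omega>. \<phi> (r (Suc k) \<omega>, s (Suc k) \<omega>) \<omega> \<partial>\<Omega>)
    = (\<integral>\<^sup>+\<omega>. (\<Sum>ab\<in>UNIV. ennreal (p (r k \<omega>) (fst ab) * q (s k \<omega>) (snd ab)) * \<phi> ab \<omega>) \<partial>\<Omega>)"
proof -
  define c where "c ab \<pi> = \<phi> ab (SOME \<omega>'. \<omega>' \<in> cyl k \<pi>)" for ab \<pi>
  define P where "P ab \<pi> = ennreal (p (fst (\<pi> k)) (fst ab) * q (snd (\<pi> k)) (snd ab))"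
    for ab and \<pi> :: "nat \<Rightarrow> 'a \<times> 'b"
  define N where "N \<pi> ab = cyl k \<pi> \<inter> {\<omega>. (r (Suc k) \<omega>, s (Suc k) \<omega>) = ab}" for \<pi> ab
  have \<phi>: "\<phi> ab \<omega> = (\<Sum>\<pi>\<in>paths k. c ab \<pi> * indicator (cyl k \<pi>) \<omega>)" if "\<omega> \<in> space \<Omega>" for ab \<omega>
    unfolding c_def by (rule path_determined_simple[OF assms that])
  have [measurable]: "N \<pi> ab \<in> events" for \<pi> ab
  proof -
    have "N \<pi> ab = cyl (Suc k) (\<pi>(Suc k := ab))" by (auto simp: N_def cyl_def le_Suc_eq)
    then show ?thesis by simp
  qed
  have "(\<integral>\<^sup>+\<omega>. \<phi> (r (Suc k) \<omega>, s (Suc k) \<omega>) \<omega> \<partial>\<Omega>)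
    = (\<integral>\<^sup>+\<omega>. (\<Sum>ab\<in>UNIV. \<Sum>\<pi>\<in>paths k. c ab \<pi> * indicator (N \<pi> ab) \<omega>) \<partial>\<Omega>)"
  proof (intro nn_integral_cong)
    fix \<omega> assume \<omega>: "\<omega> \<in> space \<Omega>"
    \<comment> \<open>For \<open>ab\<close> different from the actual next pair every indicator
      vanishes; for the actual one the inner sum is the step-function expansion.\<close>
    have "(\<Sum>ab\<in>UNIV. \<Sum>\<pi>\<in>paths k. c ab \<pi> * indicator (N \<pi> ab) \<omega>)
      = (\<Sum>ab\<in>UNIV. if ab = (r (Suc k) \<omega>, s (Suc k) \<omega>) then \<phi> ab \<omega> else 0)"
      by (intro sum.cong refl) (auto simp: N_def \<phi>[OF \<omega>] indicator_def intro!: sum.cong)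
    then show "\<phi> (r (Suc k) \<omega>, s (Suc k) \<omega>) \<omega> = (\<Sum>ab\<in>UNIV. \<Sum>\<pi>\<in>paths k. c ab \<pi> * indicator (N \<pi> ab) \<omega>)"
      by simp
  qed
  also have "\<dots> = (\<Sum>ab\<in>UNIV. \<Sum>\<pi>\<in>paths k. c ab \<pi> * emeasure \<Omega> (N \<pi> ab))"
    by (simp add: nn_integral_sum nn_integral_cmult)
  also have "\<dots> = (\<Sum>ab\<in>UNIV. \<Sum>\<pi>\<in>paths k. (P ab \<pi> * c ab \<pi>) * emeasure \<Omega> (cyl k \<pi>))"
    unfolding N_def emeasure_cyl_next P_def by (simp add: mult_ac)
  also have "\<dots> = (\<integral>\<^sup>+\<omega>. (\<Sum>ab\<in>UNIV. \<Sum>\<pi>\<in>paths k. (P ab \<pi> * c ab \<pi>) * indicator (cyl k \<pi>) \<omega>) \<partial>\<Omega>)"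
    by (simp add: nn_integral_sum nn_integral_cmult)
  also have "\<dots> = (\<integral>\<^sup>+\<omega>. (\<Sum>ab\<in>UNIV. ennreal (p (r k \<omega>) (fst ab) * q (s k \<omega>) (snd ab)) * \<phi> ab \<omega>) \<partial>\<Omega>)"
  proof (intro nn_integral_cong sum.cong refl)
    fix \<omega> ab assume \<omega>: "\<omega> \<in> space \<Omega>"
    have "P ab \<pi> * c ab \<pi> * indicator (cyl k \<pi>) \<omega>
      = ennreal (p (r k \<omega>) (fst ab) * q (s k \<omega>) (snd ab)) * (c ab \<pi> * indicator (cyl k \<pi>) \<omega>)" for \<pi>
    proof (cases "\<omega> \<in> cyl k \<pi>")
      case True
      then have "\<pi> k = (r k \<omega>, s k \<omega>)" by (auto simp: cyl_def)
      then show ?thesis by (simp add: P_def mult_ac)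
    qed simp
    then show "(\<Sum>\<pi>\<in>paths k. (P ab \<pi> * c ab \<pi>) * indicator (cyl k \<pi>) \<omega>)
      = ennreal (p (r k \<omega>) (fst ab) * q (s k \<omega>) (snd ab)) * \<phi> ab \<omega>"
      by (simp add: \<phi>[OF \<omega>] sum_distrib_left)
  qed
  finally show ?thesis .
qed

text \<open>Events of the history cannot separate two points with the same path up to
  \<open>k\<close>. Singletons are closed in a T1 space, hence Borel, so a measurable function
  cannot separate them either.\<close>

lemma history_path_determined:
  fixes u :: "'w \<Rightarrow> 'c::t1_space"
  assumes "u \<in> borel_measurable (history \<Omega> r s k)"
  shows "path_determined k u"
proof -
  define G where "G = {r j -` S \<inter> space \<Omega> | j S. j \<le> k} \<union> {s j -` S \<inter> space \<Omega> | j S. j \<le> k}"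
  have G: "G \<subseteq> Pow (space \<Omega>)" by (auto simp: G_def)
  have sp: "space (history \<Omega> r s k) = space \<Omega>" and st: "sets (history \<Omega> r s k) = sigma_sets (space \<Omega>) G"
    using G by (auto simp: history_def G_def space_measure_of_conv sets_measure_of)
  show ?thesis unfolding path_determined_def
  proof (intro ballI impI)
    fix \<omega> \<omega>' assume \<omega>: "\<omega> \<in> space \<Omega>" "\<omega>' \<in> space \<Omega>" and *: "\<forall>j\<le>k. r j \<omega> = r j \<omega>' \<and> s j \<omega> = s j \<omega>'"
    \<comment> \<open>Non-separation holds for the generators and survives complements and countable
      unions.\<close>
    have sat: "\<omega> \<in> U \<longleftrightarrow> \<omega>' \<in> U" if "U \<in> sigma_sets (space \<Omega>) G" for U
      using that by induction (use \<omega> * in \<open>auto simp: G_def\<close>)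
    have "u -` {u \<omega>} \<inter> space \<Omega> \<in> sigma_sets (space \<Omega>) G"
      using measurable_sets[OF assms, of "{u \<omega>}"] by (simp add: sp st)
    from sat[OF this] \<omega> show "u \<omega> = u \<omega>'" by auto
  qed
qed

end

section \<open>Dissipation along the closed loop\<close>

lemma xtrans_nonneg:
  assumes "\<And>a a'. 0 \<le> p a a'" "\<And>b b'. 0 \<le> q b b'"
  shows "0 \<le> xtrans p q f T c c'"
  using assms by (auto simp: xtrans_def split: prod.splits)

text \<open>The mean storage after one transition from \<open>c\<close>, with the new system state
  \<open>v\<close> held fixed because it is already known before the transition.\<close>

definition expected_storage ::
  "('a \<Rightarrow> 'a \<Rightarrow> real) \<Rightarrow> ('b \<Rightarrow> 'b \<Rightarrow> real) \<Rightarrow> ('b \<Rightarrow> bool) \<Rightarrow> nat \<Rightarrow>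
   (('a, 'b) xstate \<Rightarrow> 'v \<Rightarrow> real) \<Rightarrow> ('a, 'b) xstate \<Rightarrow> 'v \<Rightarrow> real" where
  "expected_storage p q f T V c v = (\<Sum>c'\<in>xstates f T. xtrans p q f T c c' * V c' v)"

lemma quadratic_form_Fbar:
  fixes b :: "real ^ 'n"
  shows "b \<bullet> (Fbar p q f T Z c *v b) = (\<Sum>c'\<in>xstates f T. xtrans p q f T c c' * (b \<bullet> (Z c c' *v b)))"
proof -
  have "(\<Sum>c'\<in>S. h c') *v b = (\<Sum>c'\<in>S. h c' *v b)"
    for S and h :: "('a, 'b) xstate \<Rightarrow> real ^ 'n ^ 'n"
    by (induction S rule: infinite_finite_induct) (auto simp: matrix_vector_mult_add_rdistrib)
  then show ?thesis
    by (simp add: Fbar_def inner_sum_right scaleR_matrix_vector_assoc[symmetric])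
qed

section \<open>Closed-loop matrices on extended states and the uniform dissipation margin\<close>

context
  fixes A :: "'a::finite \<Rightarrow> real ^ 'n::finite ^ 'n"
    and B :: "'a \<Rightarrow> real ^ 'm::finite ^ 'n"
    and C :: "'a \<Rightarrow> real ^ 'n ^ 'l::finite"
    and D :: "'a \<Rightarrow> real ^ 'm ^ 'l"
    and E :: "'a \<Rightarrow> real ^ 'q::finite ^ 'n"
    and K :: "'a \<Rightarrow> nat \<Rightarrow> real ^ 'n ^ 'm"
begin

definition Acl :: "('a, 'b) xstate \<Rightarrow> real ^ 'n ^ 'n" where
  "Acl = (\<lambda>(\<alpha>, \<beta>, \<gamma>, \<delta>). A \<alpha> + B \<alpha> ** K \<gamma> \<delta>)"

definition Ccl :: "('a, 'b) xstate \<Rightarrow> real ^ 'n ^ 'l" where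
  "Ccl = (\<lambda>(\<alpha>, \<beta>, \<gamma>, \<delta>). C \<alpha> + D \<alpha> ** K \<gamma> \<delta>)"

lemma cl_state_Suc:
  "cl_state A B E K f T \<tau>0 \<sigma>0 r s w x0 (Suc k) =
    Acl (ext_state f T \<tau>0 \<sigma>0 r s k) *v cl_state A B E K f T \<tau>0 \<sigma>0 r s w x0 k + E (r k) *v w k"
  by (simp add: Acl_def ext_state_def)

lemma cl_output_eq:
  "cl_output A B C D E K f T \<tau>0 \<sigma>0 r s w x0 k =
    Ccl (ext_state f T \<tau>0 \<sigma>0 r s k) *v cl_state A B E K f T \<tau>0 \<sigma>0 r s w x0 k"
  by (simp add: cl_output_def Ccl_def ext_state_def)

lemma LMI_uniform_dissipation:
  fixes p :: "'a \<Rightarrow> 'a \<Rightarrow> real" and q :: "'b::finite \<Rightarrow> 'b \<Rightarrow> real"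
    and H X :: "('a, 'b) xstate \<Rightarrow> real ^ 'n ^ 'n"
  assumes p: "\<And>a a'. 0 \<le> p a a'" and q: "\<And>b b'. 0 \<le> q b b'" and "T > 0"
    and lmi1: "\<And>\<alpha> \<beta> \<gamma> \<delta>. (\<alpha>, \<beta>, \<gamma>, \<delta>) \<in> xstates f T \<Longrightarrow>
      pos_def (sym_block4
        (G \<gamma> \<delta> + transpose (G \<gamma> \<delta>) - X (\<alpha>, \<beta>, \<gamma>, \<delta>))
        0 (g *\<^sub>R mat 1)
        (A \<alpha> ** G \<gamma> \<delta> + B \<alpha> ** F \<gamma> \<delta>) (E \<alpha>)
          (H (\<alpha>, \<beta>, \<gamma>, \<delta>) + transpose (H (\<alpha>, \<beta>, \<gamma>, \<delta>)) - Fbar p q f T Z (\<alpha>, \<beta>, \<gamma>, \<delta>))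
        (C \<alpha> ** G \<gamma> \<delta> + D \<alpha> ** F \<gamma> \<delta>) 0 0 (mat 1))"
    and lmi2: "\<And>c c'. c \<in> xstates f T \<Longrightarrow> c' \<in> xstates f T \<Longrightarrow>
      pos_def (sym_block2 (Z c c') (H c) (X c'))"
    and K: "\<And>\<alpha> \<beta> \<gamma> \<delta>. (\<alpha>, \<beta>, \<gamma>, \<delta>) \<in> xstates f T \<Longrightarrow> K \<gamma> \<delta> = F \<gamma> \<delta> ** matrix_inv (G \<gamma> \<delta>)"
  defines "V \<equiv> \<lambda>c v. v \<bullet> (matrix_inv (X c) *v v)"
  obtains \<epsilon> where "\<epsilon> > 0"
    "\<And>c x w. c \<in> xstates f T \<Longrightarrow>
      expected_storage p q f T V c (Acl c *v x + E (fst c) *v w) + (norm (Ccl c *v x))\<^sup>2 + \<epsilon> * (norm x)\<^sup>2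
        \<le> V c x + (g - \<epsilon>) * (norm w)\<^sup>2"
proof -
  let ?S = "expected_storage p q f T V"
  have X: "pos_def (X c)" if "c \<in> xstates f T" for c
    using lmi2[OF that that] by (rule pos_def_sym_block2_lower)
  have V0: "V c v \<ge> 0" if "c \<in> xstates f T" for c v
    using pos_def_inv_pos[OF X[OF that], of v] by (cases "v = 0") (auto simp: V_def intro: less_imp_le)
  have xt: "0 \<le> xtrans p q f T c c'" for c c'
    using p q by (rule xtrans_nonneg)
  \<comment> \<open>The dissipation gap, regarded as one form in the pair \<open>(x, w)\<close> so
    that a single compactness argument gives a margin in both variables.\<close>
  define Q where "Q c = (\<lambda>(x, w). V c x + g * (norm w)\<^sup>2
      - ?S c (Acl c *v x + E (fst c) *v w) - (norm (Ccl c *v x))\<^sup>2)" for c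
  have Q_pos: "Q c v > 0" if c: "c \<in> xstates f T" and "v \<noteq> 0" for c v
  proof -
    obtain x w where v: "v = (x, w)" by (cases v)
    obtain \<alpha> \<beta> \<gamma> \<delta> where c_eq: "c = (\<alpha>, \<beta>, \<gamma>, \<delta>)" by (metis prod_cases4)
    note c' = c[unfolded c_eq]
    have "?S c ((A \<alpha> + B \<alpha> ** (F \<gamma> \<delta> ** matrix_inv (G \<gamma> \<delta>))) *v x + E \<alpha> *v w)
      + (norm ((C \<alpha> + D \<alpha> ** (F \<gamma> \<delta> ** matrix_inv (G \<gamma> \<delta>))) *v x))\<^sup>2
      < x \<bullet> (matrix_inv (X c) *v x) + g * (norm w)\<^sup>2"
    proof (rule LMI_dissipation)
      show "pos_def (sym_block4 (G \<gamma> \<delta> + transpose (G \<gamma> \<delta>) - X c) 0 (g *\<^sub>R mat 1)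
         (A \<alpha> ** G \<gamma> \<delta> + B \<alpha> ** F \<gamma> \<delta>) (E \<alpha>) (H c + transpose (H c) - Fbar p q f T Z c)
         (C \<alpha> ** G \<gamma> \<delta> + D \<alpha> ** F \<gamma> \<delta>) 0 0 (mat 1))"
        unfolding c_eq by (rule lmi1[OF c'])
      show "pos_def (X c)" by (rule X[OF c])
      \<comment> \<open>The Schur bound holds for each successor state separately; averaging with
        the transition weights turns the right side into the form of \<open>Fbar\<close>.\<close>
      show "?S c (H c *v b) \<le> b \<bullet> (Fbar p q f T Z c *v b)" for b
        unfolding quadratic_form_Fbar expected_storage_def V_def
        by (intro sum_mono mult_left_mono pos_def_sym_block2_Schur lmi2 c xt)
      show "?S c v \<ge> 0" for v
        unfolding expected_storage_def by (intro sum_nonneg mult_nonneg_nonneg xt V0)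
      show "?S c (- v) = ?S c v" for v
        by (simp add: expected_storage_def V_def linear_neg[OF matrix_vector_mul_linear])
      show "(x, w) \<noteq> 0" using \<open>v \<noteq> 0\<close> v by simp
    qed
    then show ?thesis
      by (simp add: Q_def v c_eq Acl_def Ccl_def K[OF c'] V_def)
  qed
  have Q_hom: "Q c (a *\<^sub>R v) = a\<^sup>2 * Q c v" for c a v
  proof -
    have V: "V c (a *\<^sub>R v) = a\<^sup>2 * V c v" for c v
      by (simp add: V_def matrix_vector_mult_scaleR power2_eq_square)
    have S: "?S c (a *\<^sub>R v) = a\<^sup>2 * ?S c v" for v
      by (simp add: expected_storage_def V sum_distrib_left mult_ac)
    obtain x w where v: "v = (x, w)" by (cases v)
    have "Acl c *v (a *\<^sub>R x) + E (fst c) *v (a *\<^sub>R w) = a *\<^sub>R (Acl c *v x + E (fst c) *v w)"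
      by (simp add: matrix_vector_mult_scaleR scaleR_add_right)
    then show ?thesis
      unfolding Q_def v scaleR_Pair prod.case
      by (simp add: V S matrix_vector_mult_scaleR power_mult_distrib) (simp add: algebra_simps)
  qed
  have Q_cont: "continuous_on UNIV (Q c)" for c
    unfolding Q_def case_prod_beta V_def expected_storage_def
    by (intro continuous_intros bounded_linear.continuous_on[OF matrix_vector_mul_bounded_linear])
  have "\<exists>\<epsilon>>0. \<forall>v. \<epsilon> * (norm v)\<^sup>2 \<le> Q c v" if "c \<in> xstates f T" for c
    by (rule quadratic_growth[OF Q_cont[of c] Q_hom Q_pos[OF that]]) blast+
  then obtain \<epsilon> where "\<epsilon> > 0" and \<epsilon>: "\<And>c. c \<in> xstates f T \<Longrightarrow> \<forall>v. \<epsilon> * (norm v)\<^sup>2 \<le> Q c v"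
    by (rule finite_uniform_pos[OF finite_xstates, where P = "\<lambda>c \<epsilon>. \<forall>v. \<epsilon> * (norm v)\<^sup>2 \<le> Q c v"])
      (auto intro: order_trans[OF mult_right_mono])
  \<comment> \<open>The squared norm of a pair is the sum of the squared norms, so the margin splits
    into an \<open>x\<close> part and a \<open>w\<close> part.\<close>
  have "?S c (Acl c *v x + E (fst c) *v w) + (norm (Ccl c *v x))\<^sup>2 + \<epsilon> * (norm x)\<^sup>2
        \<le> V c x + (g - \<epsilon>) * (norm w)\<^sup>2" if "c \<in> xstates f T" for c x w
    using \<epsilon>[OF that, rule_format, of "(x, w)"]
    by (simp add: Q_def norm_prod_def algebra_simps)
  then show ?thesis by (rule that[OF \<open>\<epsilon> > 0\<close>])
qed

end

section \<open>Expected storage along the random closed-loop trajectories\<close>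

context mode_chains
begin

lemma path_determined_mono: "path_determined j \<phi> \<Longrightarrow> j \<le> k \<Longrightarrow> path_determined k \<phi>"
  unfolding path_determined_def by (meson order_trans)

lemma path_determined_compose2:
  "path_determined k u \<Longrightarrow> path_determined k v \<Longrightarrow> path_determined k (\<lambda>\<omega>. h (u \<omega>) (v \<omega>))"
  unfolding path_determined_def by metis

lemma path_determined_const: "path_determined k (\<lambda>_. c)"
  by (simp add: path_determined_def)

lemma path_determined_r: "path_determined k (r k)"
  by (simp add: path_determined_def)

abbreviation ext_state_at where
  "ext_state_at f T \<tau>0 \<sigma>0 k \<omega> \<equiv> ext_state f T \<tau>0 \<sigma>0 (\<lambda>j. r j \<omega>) (\<lambda>j. s j \<omega>) k"

lemma path_determined_ext_state:
  "T > 0 \<Longrightarrow> path_determined k (ext_state_at f T \<tau>0 \<sigma>0 k)"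
  unfolding path_determined_def by (intro ballI impI ext_state_cong) auto

text \<open>As \<open>y\<close> is known at time \<open>k\<close>, only the extended state jumps;
  \<open>nn_integral_next\<close> averages over the new chain values and \<open>sum_xtrans\<close>
  recognises the average.\<close>

lemma nn_integral_storage_Suc:
  assumes "T > 0" and V: "\<And>c v. c \<in> xstates f T \<Longrightarrow> 0 \<le> V c v" and y: "path_determined k y"
  shows "(\<integral>\<^sup>+\<omega>. ennreal (V (ext_state_at f T \<tau>0 \<sigma>0 (Suc k) \<omega>) (y \<omega>)) \<partial>\<Omega>)
    = (\<integral>\<^sup>+\<omega>. ennreal (expected_storage p q f T V (ext_state_at f T \<tau>0 \<sigma>0 k \<omega>) (y \<omega>)) \<partial>\<Omega>)"
proof -
  let ?\<eta> = "ext_state_at f T \<tau>0 \<sigma>0"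
  let ?\<phi> = "\<lambda>ab \<omega>. ennreal (V (next_xstate f T (?\<eta> k \<omega>) (fst ab) (snd ab)) (y \<omega>))"
  have "(\<integral>\<^sup>+\<omega>. ennreal (V (?\<eta> (Suc k) \<omega>) (y \<omega>)) \<partial>\<Omega>)
    = (\<integral>\<^sup>+\<omega>. ?\<phi> (r (Suc k) \<omega>, s (Suc k) \<omega>) \<omega> \<partial>\<Omega>)"
    by (simp add: ext_state_Suc assms(1))
  also have "\<dots> = (\<integral>\<^sup>+\<omega>. (\<Sum>ab\<in>UNIV. ennreal (p (r k \<omega>) (fst ab) * q (s k \<omega>) (snd ab)) * ?\<phi> ab \<omega>) \<partial>\<Omega>)"
    by (rule nn_integral_next)
      (rule path_determined_compose2[OF path_determined_ext_state[OF assms(1)] y])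
  also have "\<dots> = (\<integral>\<^sup>+\<omega>. ennreal (expected_storage p q f T V (?\<eta> k \<omega>) (y \<omega>)) \<partial>\<Omega>)"
  proof (rule nn_integral_cong)
    fix \<omega>
    have "expected_storage p q f T V (?\<eta> k \<omega>) (y \<omega>) = (\<Sum>ab\<in>UNIV. p (r k \<omega>) (fst ab) * q (s k \<omega>) (snd ab)
       * V (next_xstate f T (?\<eta> k \<omega>) (fst ab) (snd ab)) (y \<omega>))"
      unfolding expected_storage_def
      by (subst sum_xtrans[OF assms(1) ext_state_def]) (simp add: case_prod_beta)
    then show "(\<Sum>ab\<in>UNIV. ennreal (p (r k \<omega>) (fst ab) * q (s k \<omega>) (snd ab)) * ?\<phi> ab \<omega>)
      = ennreal (expected_storage p q f T V (?\<eta> k \<omega>) (y \<omega>))"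
      by (simp add: sum_ennreal[symmetric] ennreal_mult V assms(1) next_xstate_in_xstates p_nonneg q_nonneg)
  qed
  finally show ?thesis .
qed

context
  fixes A :: "'a \<Rightarrow> real ^ 'n::finite ^ 'n"
    and B :: "'a \<Rightarrow> real ^ 'm::finite ^ 'n"
    and E :: "'a \<Rightarrow> real ^ 'q::finite ^ 'n"
    and K :: "'a \<Rightarrow> nat \<Rightarrow> real ^ 'n ^ 'm"
    and f :: "'b \<Rightarrow> bool" and T :: nat and \<tau>0 :: int and \<sigma>0 :: 'a
    and V :: "('a, 'b) xstate \<Rightarrow> real ^ 'n \<Rightarrow> real"
  assumes T: "T > 0"
    and V: "\<And>c v. c \<in> xstates f T \<Longrightarrow> 0 \<le> V c v"
begin

abbreviation \<eta> :: "nat \<Rightarrow> 'w \<Rightarrow> ('a, 'b) xstate" where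
  "\<eta> \<equiv> ext_state_at f T \<tau>0 \<sigma>0"

abbreviation state :: "(nat \<Rightarrow> 'w \<Rightarrow> real ^ 'q) \<Rightarrow> real ^ 'n \<Rightarrow> nat \<Rightarrow> 'w \<Rightarrow> real ^ 'n" where
  "state w x0 k \<omega> \<equiv>
     cl_state A B E K f T \<tau>0 \<sigma>0 (\<lambda>j. r j \<omega>) (\<lambda>j. s j \<omega>) (\<lambda>j. w j \<omega>) x0 k"

text \<open>The state at time \<open>Suc k\<close> is already determined by the paths up to
  \<open>k\<close>. This one-step lead is what allows the expectation over the next transition with
  the new state held fixed.\<close>

lemma path_determined_state_step:
  assumes "path_determined k (w k)" "path_determined k (state w x0 k)"
  shows "path_determined k (state w x0 (Suc k))"
  unfolding cl_state_Suc
  by (rule path_determined_compose2[where h = "(+)"]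
      path_determined_compose2[where h = "\<lambda>c. (*v) (Acl A B K c)"]
      path_determined_compose2[where h = "\<lambda>c. (*v) (E c)"]
      path_determined_ext_state path_determined_r assms T)+

lemma path_determined_state:
  assumes "\<And>k. path_determined k (w k)"
  shows "path_determined k (state w x0 k)"
proof (induction k)
  case 0
  show ?case by (simp add: path_determined_const)
next
  case (Suc k)
  then show ?case
    using path_determined_mono[OF path_determined_state_step[OF assms Suc.IH], of "Suc k"] by simp
qed

lemma nn_integral_storage_state_Suc:
  assumes "\<And>k. path_determined k (w k)"
  shows "(\<integral>\<^sup>+\<omega>. ennreal (V (\<eta> (Suc k) \<omega>) (state w x0 (Suc k) \<omega>)) \<partial>\<Omega>)
    = (\<integral>\<^sup>+\<omega>. ennreal (expected_storage p q f T V (\<eta> k \<omega>) (state w x0 (Suc k) \<omega>)) \<partial>\<Omega>)"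
  by (rule nn_integral_storage_Suc[OF T V])
    (assumption | rule path_determined_state_step path_determined_state assms)+

text \<open>The one-step bound is iterated in expectation. The bound \<open>v0\<close> ranges over
  all extended states, since the initial extended state is itself a function of the sample
  point.\<close>

lemma storage_decay:
  assumes decay: "\<And>c x. c \<in> xstates f T \<Longrightarrow> expected_storage p q f T V c (Acl A B K c *v x) \<le> d * V c x"
    and "d \<ge> 0"
    and init: "\<And>c. c \<in> xstates f T \<Longrightarrow> V c x0 \<le> v0" and "0 \<le> v0"
  shows "(\<integral>\<^sup>+\<omega>. ennreal (V (\<eta> k \<omega>) (state (\<lambda>_ _. 0) x0 k \<omega>)) \<partial>\<Omega>) \<le> ennreal (d ^ k * v0)"
proof (induction k)
  case 0
  have "(\<integral>\<^sup>+\<omega>. ennreal (V (\<eta> 0 \<omega>) (state (\<lambda>_ _. 0) x0 0 \<omega>)) \<partial>\<Omega>) \<le> (\<integral>\<^sup>+\<omega>. ennreal v0 \<partial>\<Omega>)"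
    by (intro nn_integral_mono ennreal_leI) (simp add: init ext_state_in_xstates T)
  then show ?case by (simp add: emeasure_space_1)
next
  case (Suc k)
  let ?x = "state (\<lambda>_ _. 0) x0"
  have pd: "path_determined k (\<lambda>_. 0 :: real^'q)" for k by (rule path_determined_const)
  have "(\<integral>\<^sup>+\<omega>. ennreal (V (\<eta> (Suc k) \<omega>) (?x (Suc k) \<omega>)) \<partial>\<Omega>)
    = (\<integral>\<^sup>+\<omega>. ennreal (expected_storage p q f T V (\<eta> k \<omega>) (?x (Suc k) \<omega>)) \<partial>\<Omega>)"
    by (rule nn_integral_storage_state_Suc[OF pd])
  also have "\<dots> \<le> (\<integral>\<^sup>+\<omega>. ennreal d * ennreal (V (\<eta> k \<omega>) (?x k \<omega>)) \<partial>\<Omega>)"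
  proof (rule nn_integral_mono)
    fix \<omega>
    have c: "\<eta> k \<omega> \<in> xstates f T" by (rule ext_state_in_xstates[OF T])
    have "expected_storage p q f T V (\<eta> k \<omega>) (?x (Suc k) \<omega>) \<le> d * V (\<eta> k \<omega>) (?x k \<omega>)"
      unfolding cl_state_Suc using decay[OF c] by simp
    then show "ennreal (expected_storage p q f T V (\<eta> k \<omega>) (?x (Suc k) \<omega>))
      \<le> ennreal d * ennreal (V (\<eta> k \<omega>) (?x k \<omega>))"
      unfolding ennreal_mult[OF \<open>d \<ge> 0\<close> V[OF c], symmetric] by (rule ennreal_leI)
  qed
  also have "\<dots> = ennreal d * (\<integral>\<^sup>+\<omega>. ennreal (V (\<eta> k \<omega>) (?x k \<omega>)) \<partial>\<Omega>)"
    by (rule nn_integral_cmult, rule path_determined_measurable[of k],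
        rule path_determined_compose2[OF path_determined_ext_state[OF T] path_determined_state[OF pd]])
  also have "\<dots> \<le> ennreal d * ennreal (d ^ k * v0)"
    by (rule mult_left_mono[OF Suc.IH]) simp
  also have "\<dots> = ennreal (d ^ Suc k * v0)"
    using \<open>d \<ge> 0\<close> \<open>0 \<le> v0\<close> by (subst ennreal_mult[symmetric]) (auto simp: mult.assoc)
  finally show ?case .
qed

text \<open>The storage is comparable to the squared norm from both sides, so its geometric decay
  transfers at the price of the factor \<open>a * b\<close>.\<close>

lemma second_moment_decay:
  assumes decay: "\<And>c x. c \<in> xstates f T \<Longrightarrow> expected_storage p q f T V c (Acl A B K c *v x) \<le> d * V c x"
    and "d \<ge> 0"
    and lower: "\<And>c x. c \<in> xstates f T \<Longrightarrow> (norm x)\<^sup>2 \<le> a * V c x"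
    and upper: "\<And>c x. c \<in> xstates f T \<Longrightarrow> V c x \<le> b * (norm x)\<^sup>2"
    and "a \<ge> 0" "b \<ge> 0"
  shows "(\<integral>\<^sup>+\<omega>. ennreal ((norm (state (\<lambda>_ _. 0) x0 k \<omega>))\<^sup>2) \<partial>\<Omega>) \<le> ennreal (a * b * d ^ k * (norm x0)\<^sup>2)"
proof -
  let ?x = "state (\<lambda>_ _. 0) x0"
  have "(\<integral>\<^sup>+\<omega>. ennreal ((norm (?x k \<omega>))\<^sup>2) \<partial>\<Omega>) \<le> (\<integral>\<^sup>+\<omega>. ennreal a * ennreal (V (\<eta> k \<omega>) (?x k \<omega>)) \<partial>\<Omega>)"
  proof (rule nn_integral_mono)
    fix \<omega>
    have c: "\<eta> k \<omega> \<in> xstates f T" by (rule ext_state_in_xstates[OF T])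
    show "ennreal ((norm (?x k \<omega>))\<^sup>2) \<le> ennreal a * ennreal (V (\<eta> k \<omega>) (?x k \<omega>))"
      unfolding ennreal_mult[OF \<open>a \<ge> 0\<close> V[OF c], symmetric] by (rule ennreal_leI[OF lower[OF c]])
  qed
  also have "\<dots> = ennreal a * (\<integral>\<^sup>+\<omega>. ennreal (V (\<eta> k \<omega>) (?x k \<omega>)) \<partial>\<Omega>)"
    by (rule nn_integral_cmult, rule path_determined_measurable[of k],
        rule path_determined_compose2[OF path_determined_ext_state[OF T]
          path_determined_state[OF path_determined_const]])
  also have "\<dots> \<le> ennreal a * ennreal (d ^ k * (b * (norm x0)\<^sup>2))"
    by (intro mult_left_mono storage_decay decay \<open>d \<ge> 0\<close> upper) (auto simp: \<open>b \<ge> 0\<close>)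
  also have "\<dots> = ennreal (a * b * d ^ k * (norm x0)\<^sup>2)"
    using assms(2,5,6) by (subst ennreal_mult[symmetric]) (auto simp: mult_ac)
  finally show ?thesis .
qed

text \<open>Dissipation is integrated at each time and telescoped over time. Starting from zero, no
  initial storage remains.\<close>

lemma l2_gain:
  fixes C :: "'a \<Rightarrow> real ^ 'n ^ 'l::finite" and D :: "'a \<Rightarrow> real ^ 'm ^ 'l"
  assumes dis: "\<And>c x w. c \<in> xstates f T \<Longrightarrow>
      expected_storage p q f T V c (Acl A B K c *v x + E (fst c) *v w) + (norm (Ccl C D K c *v x))\<^sup>2
        \<le> V c x + g * (norm w)\<^sup>2"
    and "g \<ge> 0" and init: "\<And>c. c \<in> xstates f T \<Longrightarrow> V c 0 = 0"
    and w: "\<And>k. path_determined k (w k)"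
  shows "l2_sq \<Omega> (\<lambda>k \<omega>. cl_output A B C D E K f T \<tau>0 \<sigma>0
              (\<lambda>j. r j \<omega>) (\<lambda>j. s j \<omega>) (\<lambda>j. w j \<omega>) 0 k) \<le> ennreal g * l2_sq \<Omega> w"
proof -
  define v where "v k = (\<integral>\<^sup>+\<omega>. ennreal (V (\<eta> k \<omega>) (state w 0 k \<omega>)) \<partial>\<Omega>)" for k
  define z where "z k \<omega> = Ccl C D K (\<eta> k \<omega>) *v state w 0 k \<omega>" for k \<omega>
  define z2 where "z2 k = (\<integral>\<^sup>+\<omega>. ennreal ((norm (z k \<omega>))\<^sup>2) \<partial>\<Omega>)" for k
  define w2 where "w2 k = (\<integral>\<^sup>+\<omega>. ennreal ((norm (w k \<omega>))\<^sup>2) \<partial>\<Omega>)" for k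
  have pdx: "path_determined k (state w 0 k)" for k by (rule path_determined_state[OF w])
  have pdz: "path_determined k (z k)" for k
    unfolding z_def
    by (rule path_determined_compose2[where h = "\<lambda>c. (*v) (Ccl C D K c)", OF path_determined_ext_state[OF T] pdx])
  have meas [measurable]: "(\<lambda>\<omega>. ennreal (V (\<eta> k \<omega>) (state w 0 k \<omega>))) \<in> borel_measurable \<Omega>"
    "(\<lambda>\<omega>. ennreal ((norm (z k \<omega>))\<^sup>2)) \<in> borel_measurable \<Omega>"
    "(\<lambda>\<omega>. ennreal ((norm (w k \<omega>))\<^sup>2)) \<in> borel_measurable \<Omega>"
    "(\<lambda>\<omega>. ennreal (expected_storage p q f T V (\<eta> k \<omega>) (state w 0 (Suc k) \<omega>))) \<in> borel_measurable \<Omega>" for k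
  proof -
    show "(\<lambda>\<omega>. ennreal (V (\<eta> k \<omega>) (state w 0 k \<omega>))) \<in> borel_measurable \<Omega>"
      by (rule path_determined_measurable[of k],
          rule path_determined_compose2[OF path_determined_ext_state[OF T] pdx])
    show "(\<lambda>\<omega>. ennreal ((norm (z k \<omega>))\<^sup>2)) \<in> borel_measurable \<Omega>"
      by (rule path_determined_measurable[of k],
          rule path_determined_compose2[OF pdz pdz, where h = "\<lambda>u _. ennreal ((norm u)\<^sup>2)"])
    show "(\<lambda>\<omega>. ennreal ((norm (w k \<omega>))\<^sup>2)) \<in> borel_measurable \<Omega>"
      by (rule path_determined_measurable[of k],
          rule path_determined_compose2[OF w w, where h = "\<lambda>u _. ennreal ((norm u)\<^sup>2)"])
    show "(\<lambda>\<omega>. ennreal (expected_storage p q f T V (\<eta> k \<omega>) (state w 0 (Suc k) \<omega>))) \<in> borel_measurable \<Omega>"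
      by (rule path_determined_measurable[of k],
          rule path_determined_compose2[OF path_determined_ext_state[OF T] path_determined_state_step[OF w pdx]])
  qed
  have S0: "expected_storage p q f T V c u \<ge> 0" for c u
    unfolding expected_storage_def
    by (intro sum_nonneg mult_nonneg_nonneg xtrans_nonneg p_nonneg q_nonneg V)
  have step: "v (Suc k) + z2 k \<le> v k + ennreal g * w2 k" for k
  proof -
    have "v (Suc k) + z2 k = (\<integral>\<^sup>+\<omega>. ennreal (expected_storage p q f T V (\<eta> k \<omega>) (state w 0 (Suc k) \<omega>))
        + ennreal ((norm (z k \<omega>))\<^sup>2) \<partial>\<Omega>)"
      unfolding v_def z2_def nn_integral_storage_state_Suc[OF w] by (rule nn_integral_add[symmetric]) measurable
    also have "\<dots> \<le> (\<integral>\<^sup>+\<omega>. ennreal (V (\<eta> k \<omega>) (state w 0 k \<omega>)) + ennreal g * ennreal ((norm (w k \<omega>))\<^sup>2) \<partial>\<Omega>)"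
    proof (rule nn_integral_mono)
      fix \<omega>
      \<comment> \<open>The first component of the extended state is the mode, so
        \<open>E (fst c)\<close> is the disturbance matrix of the recursion.\<close>
      have "expected_storage p q f T V (\<eta> k \<omega>) (state w 0 (Suc k) \<omega>) + (norm (z k \<omega>))\<^sup>2
        \<le> V (\<eta> k \<omega>) (state w 0 k \<omega>) + g * (norm (w k \<omega>))\<^sup>2"
        using dis[OF ext_state_in_xstates[OF T], of \<tau>0 \<sigma>0 "\<lambda>j. r j \<omega>" "\<lambda>j. s j \<omega>" k "state w 0 k \<omega>" "w k \<omega>"]
        unfolding cl_state_Suc z_def by (simp add: ext_state_def)
      then have "ennreal (expected_storage p q f T V (\<eta> k \<omega>) (state w 0 (Suc k) \<omega>) + (norm (z k \<omega>))\<^sup>2)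
        \<le> ennreal (V (\<eta> k \<omega>) (state w 0 k \<omega>) + g * (norm (w k \<omega>))\<^sup>2)"
        by (rule ennreal_leI)
      then show "ennreal (expected_storage p q f T V (\<eta> k \<omega>) (state w 0 (Suc k) \<omega>)) + ennreal ((norm (z k \<omega>))\<^sup>2)
        \<le> ennreal (V (\<eta> k \<omega>) (state w 0 k \<omega>)) + ennreal g * ennreal ((norm (w k \<omega>))\<^sup>2)"
        unfolding ennreal_mult[OF \<open>g \<ge> 0\<close> zero_le_power2, symmetric]
          ennreal_plus[OF V[OF ext_state_in_xstates[OF T]] mult_nonneg_nonneg[OF \<open>g \<ge> 0\<close> zero_le_power2], symmetric]
          ennreal_plus[OF S0 zero_le_power2, symmetric] .
    qed
    also have "\<dots> = v k + ennreal g * w2 k"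
      unfolding v_def w2_def 
      by (simp add: nn_integral_add nn_integral_cmult[OF meas(3)])
    finally show ?thesis .
  qed
  \<comment> \<open>The storage terms stay on the left as summands, which avoids subtraction in
    \<open>ennreal\<close>.\<close>
  have sum: "v n + (\<Sum>k<n. z2 k) \<le> ennreal g * (\<Sum>k<n. w2 k)" for n
  proof (induction n)
    case 0
    show ?case by (simp add: v_def init ext_state_in_xstates T)
  next
    case (Suc n)
    have "v (Suc n) + (\<Sum>k<Suc n. z2 k) = (v (Suc n) + z2 n) + (\<Sum>k<n. z2 k)"
      by (simp add: ac_simps)
    also have "\<dots> \<le> (v n + ennreal g * w2 n) + (\<Sum>k<n. z2 k)"
      by (rule add_right_mono[OF step])
    also have "\<dots> = (v n + (\<Sum>k<n. z2 k)) + ennreal g * w2 n" by (simp add: ac_simps)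
    also have "\<dots> \<le> ennreal g * (\<Sum>k<n. w2 k) + ennreal g * w2 n"
      by (rule add_right_mono[OF Suc.IH])
    finally show ?case by (simp add: distrib_left)
  qed
  have "(\<Sum>k. z2 k) \<le> ennreal g * (\<Sum>k. w2 k)"
  proof (rule suminf_le_const)
    fix n
    have "(\<Sum>k<n. z2 k) \<le> v n + (\<Sum>k<n. z2 k)" by simp
    also have "\<dots> \<le> ennreal g * (\<Sum>k<n. w2 k)" by (rule sum)
    also have "\<dots> \<le> ennreal g * (\<Sum>k. w2 k)" by (intro mult_left_mono sum_le_suminf) auto
    finally show "(\<Sum>k<n. z2 k) \<le> ennreal g * (\<Sum>k. w2 k)" .
  qed simp
  then show ?thesis
    unfolding l2_sq_def cl_output_eq z2_def w2_def z_def .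
qed

end

end

section \<open>From squared norms to gain ratios, and the final bounds\<close>

lemma l2_norm_ratio_le:
  assumes le: "l2_sq M z \<le> ennreal g * l2_sq M w" and "g \<ge> 0"
    and fin: "l2_sq M w < \<infinity>" and nz: "l2_norm M w \<noteq> 0"
  shows "l2_norm M z / l2_norm M w \<le> ennreal (sqrt g)"
proof -
  define W where "W = enn2real (l2_sq M w)"
  have W: "l2_sq M w = ennreal W" "W \<ge> 0" using fin by (auto simp: W_def)
  have lw: "l2_norm M w = ennreal (sqrt W)" using fin by (simp add: l2_norm_def W_def)
  then have "W > 0" using nz W(2) by (cases "W = 0") auto
  have lz: "l2_sq M z \<le> ennreal (g * W)" using le W \<open>g \<ge> 0\<close> by (simp add: ennreal_mult)
  then have "l2_sq M z \<noteq> \<infinity>" 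
    by (metis ennreal_less_top infinity_ennreal_def leD)
  then have "l2_norm M z = ennreal (sqrt (enn2real (l2_sq M z)))" by (simp add: l2_norm_def)
  also have "\<dots> \<le> ennreal (sqrt (g * W))"
    using lz W(2) \<open>g \<ge> 0\<close> by (intro ennreal_leI real_sqrt_le_mono enn2real_leI) auto
  finally have "l2_norm M z / l2_norm M w \<le> ennreal (sqrt (g * W)) / ennreal (sqrt W)"
    unfolding lw by (rule divide_right_mono_ennreal)
  also have "\<dots> = ennreal (sqrt g)"
    using \<open>W > 0\<close> \<open>g \<ge> 0\<close> by (simp add: divide_ennreal real_sqrt_mult)
  finally show ?thesis .
qed

theorem theorem4p3:
  fixes A :: "'a::finite \<Rightarrow> real ^ 'n::finite ^ 'n"
    and B :: "'a \<Rightarrow> real ^ 'm::finite ^ 'n"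
    and C :: "'a \<Rightarrow> real ^ 'n ^ 'l::finite"
    and D :: "'a \<Rightarrow> real ^ 'm ^ 'l"
    and E :: "'a \<Rightarrow> real ^ 'q::finite ^ 'n"
    and p :: "'a \<Rightarrow> 'a \<Rightarrow> real"
    and q :: "'b::finite \<Rightarrow> 'b \<Rightarrow> real"
    and f :: "'b \<Rightarrow> bool"
    and T :: nat
    and \<Omega> :: "'a \<Rightarrow> 'b \<Rightarrow> 'w measure"
    and r :: "'a \<Rightarrow> 'b \<Rightarrow> nat \<Rightarrow> 'w \<Rightarrow> 'a"
    and s :: "'a \<Rightarrow> 'b \<Rightarrow> nat \<Rightarrow> 'w \<Rightarrow> 'b"
    and g :: real
    and H X :: "('a, 'b) xstate \<Rightarrow> real ^ 'n ^ 'n"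
    and Z :: "('a, 'b) xstate \<Rightarrow> ('a, 'b) xstate \<Rightarrow> real ^ 'n ^ 'n"
    and G :: "'a \<Rightarrow> nat \<Rightarrow> real ^ 'n ^ 'n"
    and F :: "'a \<Rightarrow> nat \<Rightarrow> real ^ 'n ^ 'm"
    and K :: "'a \<Rightarrow> nat \<Rightarrow> real ^ 'n ^ 'm"
  assumes "T > 0"
    and "mode_processes p q \<Omega> r s"
    and "g > 0"
    and "\<And>\<alpha> \<beta> \<gamma> \<delta>. (\<alpha>, \<beta>, \<gamma>, \<delta>) \<in> xstates f T \<Longrightarrow>
      pos_def (sym_block4
        (G \<gamma> \<delta> + transpose (G \<gamma> \<delta>) - X (\<alpha>, \<beta>, \<gamma>, \<delta>))
        0 (g *\<^sub>R mat 1)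
        (A \<alpha> ** G \<gamma> \<delta> + B \<alpha> ** F \<gamma> \<delta>) (E \<alpha>)
          (H (\<alpha>, \<beta>, \<gamma>, \<delta>) + transpose (H (\<alpha>, \<beta>, \<gamma>, \<delta>)) - Fbar p q f T Z (\<alpha>, \<beta>, \<gamma>, \<delta>))
        (C \<alpha> ** G \<gamma> \<delta> + D \<alpha> ** F \<gamma> \<delta>) 0 0 (mat 1))"
    and "\<And>c c'. c \<in> xstates f T \<Longrightarrow> c' \<in> xstates f T \<Longrightarrow>
      pos_def (sym_block2 (Z c c') (H c) (X c'))"
    and "\<And>\<alpha> \<beta> \<gamma> \<delta>. (\<alpha>, \<beta>, \<gamma>, \<delta>) \<in> xstates f T \<Longrightarrow>
      K \<gamma> \<delta> = F \<gamma> \<delta> ** matrix_inv (G \<gamma> \<delta>)"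
  shows "mean_square_stable A B E K f T \<Omega> r s \<and>
    (Hinf_norm A B C D E K f T \<Omega> r s)\<^sup>2 < ennreal g"
proof -
  have modes: "mode_chains (\<Omega> r0 s0) p q r0 s0 (r r0 s0) (s r0 s0)" for r0 s0
    using assms(2) by (auto simp: mode_processes_def intro!: mode_chains.intro mode_chains_axioms.intro)
  have p: "0 \<le> p a a'" and q: "0 \<le> q b b'" for a a' b b'
    using mode_chains.p_nonneg[OF modes] mode_chains.q_nonneg[OF modes] .
  define V where "V c v = v \<bullet> (matrix_inv (X c) *v v)" for c v
  obtain \<epsilon> where \<epsilon>: "\<epsilon> > 0" and dis: "\<And>c x w. c \<in> xstates f T \<Longrightarrow>
      expected_storage p q f T V c (Acl A B K c *v x + E (fst c) *v w) + (norm (Ccl C D K c *v x))\<^sup>2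
        + \<epsilon> * (norm x)\<^sup>2 \<le> V c x + (g - \<epsilon>) * (norm w)\<^sup>2"
    unfolding V_def
    by (rule LMI_uniform_dissipation[OF p q assms(1,4,5)]) (assumption | erule assms(6) | blast)+
  have X: "pos_def (X c)" if "c \<in> xstates f T" for c
    using assms(5)[OF that that] by (rule pos_def_sym_block2_lower)
  have V_pos: "V c v > 0" if "c \<in> xstates f T" "v \<noteq> 0" for c v
    unfolding V_def by (rule pos_def_inv_pos[OF X[OF that(1)] that(2)])
  have V_0: "V c 0 = 0" for c by (simp add: V_def)
  have V: "V c v \<ge> 0" if "c \<in> xstates f T" for c v
    using V_pos[OF that, of v] V_0 by (cases "v = 0") auto
  have V_hom: "V c (a *\<^sub>R v) = a\<^sup>2 * V c v" for a c v
    by (simp add: V_def matrix_vector_mult_scaleR power2_eq_square)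
  have V_cont: "continuous_on UNIV (V c)" for c
    unfolding V_def by (intro continuous_intros bounded_linear.continuous_on[OF matrix_vector_mul_bounded_linear])
  have "\<exists>\<epsilon>>0. \<forall>v. \<epsilon> * (norm v)\<^sup>2 \<le> V c v" if "c \<in> xstates f T" for c
    by (rule quadratic_growth[OF V_cont[of c] V_hom V_pos[OF that]]) blast+
  then obtain c1 where "c1 > 0" and c1: "\<And>c. c \<in> xstates f T \<Longrightarrow> \<forall>v. c1 * (norm v)\<^sup>2 \<le> V c v"
    by (rule finite_uniform_pos[OF finite_xstates, where P = "\<lambda>c \<epsilon>. \<forall>v. \<epsilon> * (norm v)\<^sup>2 \<le> V c v"])
      (auto intro: order_trans[OF mult_right_mono])
  \<comment> \<open>The upper bound on the storage is put with the constant on the left, because in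
    this form it persists when the constant shrinks, as \<open>finite_uniform_pos\<close>
    requires.\<close>
  have "\<exists>\<epsilon>>0. \<forall>v. \<epsilon> * V c v \<le> (norm v)\<^sup>2" for c
  proof -
    obtain M where M: "M > 0" "\<And>v. norm (matrix_inv (X c) *v v) \<le> norm v * M"
      using bounded_linear.pos_bounded[OF matrix_vector_mul_bounded_linear] by blast
    have "V c v \<le> norm v * (norm v * M)" for v
      unfolding V_def by (rule order_trans[OF norm_cauchy_schwarz mult_left_mono[OF M(2)]]) simp
    then have "1 / M * V c v \<le> (norm v)\<^sup>2" for v
      using M(1) by (simp add: divide_le_eq power2_eq_square mult_ac)
    then show ?thesis using M(1) by (intro exI[of _ "1 / M"]) simp
  qed
  then obtain c2 where "c2 > 0" and c2: "\<And>c. c \<in> xstates f T \<Longrightarrow> \<forall>v. c2 * V c v \<le> (norm v)\<^sup>2"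
    by (rule finite_uniform_pos[OF finite_xstates, where P = "\<lambda>c \<epsilon>. \<forall>v. \<epsilon> * V c v \<le> (norm v)\<^sup>2"])
      (auto intro: order_trans[OF mult_right_mono] V)
  \<comment> \<open>The loss \<open>\<epsilon> * (norm x)\<^sup>2\<close> is at least the fraction
    \<open>\<epsilon> * c2\<close> of the storage. The maximum keeps the rate nonnegative should
    that fraction exceed 1.\<close>
  define d where "d = max 0 (1 - \<epsilon> * c2)"
  have d: "0 \<le> d" "d < 1" using \<epsilon> \<open>c2 > 0\<close> by (auto simp: d_def)
  have decay: "expected_storage p q f T V c (Acl A B K c *v x) \<le> d * V c x" if c: "c \<in> xstates f T" for c x
  proof -
    have "expected_storage p q f T V c (Acl A B K c *v x) \<le> V c x - \<epsilon> * (norm x)\<^sup>2"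
      using dis[OF c, of x 0, simplified] zero_le_power2[of "norm (Ccl C D K c *v x)"] by linarith
    also have "\<dots> \<le> V c x - \<epsilon> * (c2 * V c x)"
      using c2[OF c] \<epsilon> by simp
    also have "\<dots> = (1 - \<epsilon> * c2) * V c x" by (simp add: algebra_simps)
    also have "\<dots> \<le> d * V c x" using V[OF c] by (intro mult_right_mono) (auto simp: d_def)
    finally show ?thesis .
  qed
  have lower: "(norm x)\<^sup>2 \<le> 1 / c1 * V c x" if "c \<in> xstates f T" for c x
    using c1[OF that] \<open>c1 > 0\<close> by (simp add: le_divide_eq mult.commute)
  have upper: "V c x \<le> 1 / c2 * (norm x)\<^sup>2" if "c \<in> xstates f T" for c x
    using c2[OF that] \<open>c2 > 0\<close> by (simp add: le_divide_eq mult.commute)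
  have "mean_square_stable A B E K f T \<Omega> r s"
    unfolding mean_square_stable_def
  proof (rule exI[of _ "1 / c1 * (1 / c2)"], rule conjI[OF _ exI[of _ d]], goal_cases)
    case 2
    show ?case
    proof (intro conjI allI impI)
      show "(\<integral>\<^sup>+\<omega>. ennreal ((norm (cl_state A B E K f T \<tau>0 \<sigma>0 (\<lambda>j. r r0 s0 j \<omega>)
            (\<lambda>j. s r0 s0 j \<omega>) (\<lambda>_. 0) x0 k))\<^sup>2) \<partial>\<Omega> r0 s0)
          \<le> ennreal (1 / c1 * (1 / c2) * d ^ k * (norm x0)\<^sup>2)" for x0 r0 s0 \<sigma>0  \<tau>0 k
        by (rule mode_chains.second_moment_decay[OF modes assms(1) V decay d(1) lower upper])
          (use \<open>c1 > 0\<close> \<open>c2 > 0\<close> in auto)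
    qed (use d in auto)
  qed (use \<open>c1 > 0\<close> \<open>c2 > 0\<close> in simp)
  moreover have "(Hinf_norm A B C D E K f T \<Omega> r s)\<^sup>2 < ennreal g"
  proof -
    \<comment> \<open>The margin is spent on the disturbance term. Truncation at 0 keeps the square
      root meaningful, and \<open>g > 0\<close> keeps the truncated value below
      \<open>g\<close>.\<close>
    define g' where "g' = max 0 (g - \<epsilon>)"
    have g': "0 \<le> g'" "g' < g" using \<epsilon> assms(3) by (auto simp: g'_def)
    have dis': "expected_storage p q f T V c (Acl A B K c *v x + E (fst c) *v w) + (norm (Ccl C D K c *v x))\<^sup>2
        \<le> V c x + g' * (norm w)\<^sup>2" if "c \<in> xstates f T" for c x w
    proof -
      have "(g - \<epsilon>) * (norm w)\<^sup>2 \<le> g' * (norm w)\<^sup>2" by (intro mult_right_mono) (auto simp: g'_def)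
      moreover have "0 \<le> \<epsilon> * (norm x)\<^sup>2" using \<epsilon> by simp
      ultimately show ?thesis using dis[OF that, of x w] by linarith
    qed
    \<comment> \<open>A supremum preserves only weak bounds, so the strict inequality rests on this
      common bound for all initial states and disturbances.\<close>
    have "Hinf_norm A B C D E K f T \<Omega> r s \<le> ennreal (sqrt g')"
      unfolding Hinf_norm_def
    proof (rule Sup_least, clarify)
      fix r0 s0 \<sigma>0 \<tau>0 and w :: "nat \<Rightarrow> 'w \<Rightarrow> real ^ 'q"
      assume w: "w \<in> l2_space (\<Omega> r0 s0) (r r0 s0) (s r0 s0)" and nz: "l2_norm (\<Omega> r0 s0) w \<noteq> 0"
      interpret mode_chains "\<Omega> r0 s0" p q r0 s0 "r r0 s0" "s r0 s0" by (rule modes)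
      \<comment> \<open>Adaptedness of the disturbance enters here.\<close>
      have pd: "path_determined k (w k)" for k
        using w by (intro history_path_determined) (simp add: l2_space_def)
      show "l2_norm (\<Omega> r0 s0) (\<lambda>k \<omega>. cl_output A B C D E K f T \<tau>0 \<sigma>0
              (\<lambda>j. r r0 s0 j \<omega>) (\<lambda>j. s r0 s0 j \<omega>) (\<lambda>j. w j \<omega>) 0 k)
         / l2_norm (\<Omega> r0 s0) w \<le> ennreal (sqrt g')"
      proof (rule l2_norm_ratio_le)
        show "l2_sq (\<Omega> r0 s0) (\<lambda>k \<omega>. cl_output A B C D E K f T \<tau>0 \<sigma>0
              (\<lambda>j. r r0 s0 j \<omega>) (\<lambda>j. s r0 s0 j \<omega>) (\<lambda>j. w j \<omega>) 0 k)
            \<le> ennreal g' * l2_sq (\<Omega> r0 s0) w"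
          by (rule l2_gain[OF assms(1) V dis' g'(1) V_0 pd])
        show "l2_sq (\<Omega> r0 s0) w < \<infinity>" using w by (simp add: l2_space_def)
      qed (use g' nz in auto)
    qed
    then have "(Hinf_norm A B C D E K f T \<Omega> r s)\<^sup>2 \<le> (ennreal (sqrt g'))\<^sup>2"
      by (rule power_mono) simp
    also have "\<dots> = ennreal g'" using g'(1) by (simp add: ennreal_power)
    also have "\<dots> < ennreal g" using g' by (simp add: ennreal_less_iff)
    finally show ?thesis .
  qed
  ultimately show ?thesis by blast
qed

end
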